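(* Let $n\ge 1$, let $m$ be a non-negative integer, let $\alpha>0$, let $0<q<\infty$, and let $\mu\geq 0$ be a positive Borel measure on $\mathbb{C}^n$. Then the following statements are equivalent. (i) $\mu$ is an $(\infty,q)$ Fock--Carleson measure for the Fock--Sobolev spaces of order $m$; (ii) $\mu$ is an $(\infty,q)$ vanishing Fock--Carleson measure for the Fock--Sobolev spaces of order $m$; (iii) $\widetilde{\mu}_{(t,mq)}\in L^1$ for some (or any) $t>0$; (iv) $\mu_{(mq,r,D)}\in L^1$ for some (or any) $r>0$; (v) $\big(\mu_{(mq,r,D)}(z_k)\big)_k\in\ell^1$ for some (or any) $r>0$; (vi) $\mu_{mq}$ is a finite measure on $\mathbb{C}^n$. Moreover, $$\|\mu\|^q\simeq\|\widetilde{\mu}_{(t,mq)}\|_{L^1}\simeq\|\mu_{(mq,r,D)}\|_{L^1}\simeq\mu_{mq}(\mathbb{C}^n)\simeq\|\mu_{(mq,r,D)}(z_k)\|_{\ell^1}.$$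
   Context: $dV$ is Lebesgue measure on $\mathbb{C}^n$, $\langle z,w\rangle=\sum_j z_j\overline{w_j}$, $|z|=\sqrt{\langle z,z\rangle}$, $L^1=L^1(\mathbb{C}^n,dV)$. The Fock--Sobolev space $\mathcal{F}^\infty_{(m,\alpha)}$ of order $m$ consists of the entire functions $f$ on $\mathbb{C}^n$ with $\sum_{\beta_1+\dots+\beta_n\le m}\sup_z|\partial^\beta f(z)|e^{-\frac{\alpha}{2}|z|^2}<\infty$. It is equipped throughout with the equivalent norm $\|f\|_{(\infty,m)}=\sup_{z\in\mathbb{C}^n}|z|^m|f(z)|e^{-\frac{\alpha}{2}|z|^2}$. $\mu$ is an $(\infty,q)$ Fock--Carleson measure if there is a constant $C$ with $\int_{\mathbb{C}^n}|f(z)|^qe^{-\frac{\alpha q}{2}|z|^2}d\mu(z)\le C^q\|f\|_{(\infty,m)}^q$ for all $f\in\mathcal{F}^\infty_{(m,\alpha)}$, i.e. the embedding $I_\mu:\mathcal{F}^\infty_{(m,\alpha)}\to L^q(\sigma_q)$, $d\sigma_q(z)=e^{-\frac{q\alpha}{2}|z|^2}d\mu(z)$, is bounded; $\|\mu\|=\|I_\mu\|$ is the smallest such $C$. $\mu$ is an $(\infty,q)$ vanishing Fock--Carleson measure if $\lim_{j\to\infty}\int_{\mathbb{C}^n}|f_j(z)|^qe^{-\frac{q\alpha}{2}|z|^2}d\mu(z)=0$ whenever $(f_j)$ is a sequence in $\mathcal{F}^\infty_{(m,\alpha)}$ with $\sup_j\|f_j\|_{(\infty,m)}<\infty$ that converges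 to zero uniformly on compact subsets of $\mathbb{C}^n$ as $j\to\infty$. For $s\ge0$, $\mu_s$ is the measure $d\mu_s(z)=(1+|z|)^{-s}d\mu(z)$. For $t>0$, $s\ge 0$, the $(t,s)$-Berezin type transform is $\widetilde{\mu}_{(t,s)}(w)=\int_{\mathbb{C}^n}(1+|z|)^{-s}e^{-\frac{t\alpha}{2}|z-w|^2}d\mu(z)$. With $D(z,r)=\{w\in\mathbb{C}^n:|z-w|<r\}$, put $\mu_{(s,r,D)}(z)=\mu(D(z,r))/(1+|z|)^s$. A sequence of distinct points $(z_k)_{k\in\mathbb{N}}$ is an $r/2$-lattice for $\mathbb{C}^n$ if the balls $D(z_k,r)$ cover $\mathbb{C}^n$ and the balls $D(z_k,r/2)$ are mutually disjoint. In conditions involving $(z_k)$ and $r$, $(z_k)$ is an $r/2$-lattice for that $r$. "For some (or any)" means that the condition for one value of the parameter is equivalent to the condition for every value. $U\simeq V$ means $U\le CV$ and $V\le CU$ with a constant $C$ independent of $\mu$. *)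

theory Defs
  imports "HOL-Analysis.Analysis"
begin

section \<open>Entire functions on \<open>\<complex>\<^sup>n\<close> and their partial derivatives\<close>

text \<open>
  The space \<open>\<complex>\<^sup>n\<close> is rendered as the type \<open>complex ^ 'n\<close>, with its Euclidean norm
  and with Lebesgue measure \<open>lborel\<close>.
\<close>

definition entire_fun :: "(complex ^ 'n \<Rightarrow> complex) \<Rightarrow> bool" where
  "entire_fun f \<longleftrightarrow>
     (\<forall>z. \<exists>f'. (f has_derivative f') (at z) \<and> (\<forall>c v. f' (c *s v) = c * f' v))"

definition cpartial :: "'n \<Rightarrow> (complex ^ 'n \<Rightarrow> complex) \<Rightarrow> complex ^ 'n \<Rightarrow> complex" where
  "cpartial i f z = deriv (\<lambda>w. f (z + w *s axis i 1)) 0"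

text \<open>
  The derivative \<open>\<partial>\<^sup>\<beta> f\<close> for a multi-index \<open>\<beta>\<close>. The finite index type \<open>'n\<close> carries no order,
  so the partial derivatives are taken along some fixed enumeration of the coordinates; for
  the entire functions, to which this is applied, the enumeration is immaterial.
\<close>

definition multi_deriv ::
    "('n::finite \<Rightarrow> nat) \<Rightarrow> (complex ^ 'n \<Rightarrow> complex) \<Rightarrow> complex ^ 'n \<Rightarrow> complex" where
  "multi_deriv \<beta> f =
     foldr (\<lambda>i. cpartial i ^^ \<beta> i) (SOME is. distinct is \<and> set is = UNIV) f"

definition multi_indices :: "nat \<Rightarrow> ('n::finite \<Rightarrow> nat) set" where
  "multi_indices m = {\<beta>. (\<Sum>i\<in>UNIV. \<beta> i) \<le> m}"

lemma finite_multi_indices: "finite (multi_indices m :: ('n::finite \<Rightarrow> nat) set)"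
proof (rule finite_subset)
  show "(multi_indices m :: ('n \<Rightarrow> nat) set) \<subseteq> PiE UNIV (\<lambda>_. {..m})"
  proof
    fix \<beta> :: "'n \<Rightarrow> nat"
    assume "\<beta> \<in> multi_indices m"
    then have s: "(\<Sum>i\<in>UNIV. \<beta> i) \<le> m"
      by (simp add: multi_indices_def)
    have "\<beta> i \<le> m" for i
      using member_le_sum[of i UNIV \<beta>] s by simp
    then show "\<beta> \<in> PiE UNIV (\<lambda>_. {..m})"
      by auto
  qed
qed (auto intro: finite_PiE)

section \<open>Fock--Sobolev spaces\<close>

text \<open>
  Norms are valued in \<open>[0, \<infinity>]\<close>, so that no supremum or integral takes a dummy value. The
  power \<open>x\<^sup>q\<close> on \<open>[0, \<infinity>]\<close> is only used for \<open>q > 0\<close>.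
\<close>

definition ennpowr :: "ennreal \<Rightarrow> real \<Rightarrow> ennreal" where
  "ennpowr x q = (if x = \<infinity> then \<infinity> else ennreal (enn2real x powr q))"

definition fock_sobolev :: "real \<Rightarrow> nat \<Rightarrow> (complex ^ 'n::finite \<Rightarrow> complex) set" where
  "fock_sobolev \<alpha> m =
     {f. entire_fun f \<and>
         (\<Sum>\<beta>\<in>multi_indices m.
            SUP z. ennreal (cmod (multi_deriv \<beta> f z) * exp (- (\<alpha> / 2) * (norm z)\<^sup>2))) < \<infinity>}"

definition fs_norm :: "real \<Rightarrow> nat \<Rightarrow> (complex ^ 'n::finite \<Rightarrow> complex) \<Rightarrow> ennreal" where
  "fs_norm \<alpha> m f =
     (SUP z. ennreal (norm z ^ m * cmod (f z) * exp (- (\<alpha> / 2) * (norm z)\<^sup>2)))"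

section \<open>Fock--Carleson measures\<close>

text \<open>The \<open>q\<close>-th power of the norm of \<open>f\<close> in \<open>L\<^sup>q(\<sigma>\<^sub>q)\<close>.\<close>

definition fc_integral ::
    "real \<Rightarrow> real \<Rightarrow> (complex ^ 'n::finite) measure \<Rightarrow> (complex ^ 'n \<Rightarrow> complex) \<Rightarrow> ennreal" where
  "fc_integral \<alpha> q \<mu> f =
     (\<integral>\<^sup>+ z. ennreal (cmod (f z) powr q * exp (- (\<alpha> * q / 2) * (norm z)\<^sup>2)) \<partial>\<mu>)"

definition fc_bound ::
    "real \<Rightarrow> nat \<Rightarrow> real \<Rightarrow> (complex ^ 'n::finite) measure \<Rightarrow> ennreal \<Rightarrow> bool" where
  "fc_bound \<alpha> m q \<mu> C \<longleftrightarrow>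
     (\<forall>f\<in>fock_sobolev \<alpha> m. fc_integral \<alpha> q \<mu> f \<le> ennpowr C q * ennpowr (fs_norm \<alpha> m f) q)"

definition fock_carleson ::
    "real \<Rightarrow> nat \<Rightarrow> real \<Rightarrow> (complex ^ 'n::finite) measure \<Rightarrow> bool" where
  "fock_carleson \<alpha> m q \<mu> \<longleftrightarrow> (\<exists>C<\<infinity>. fc_bound \<alpha> m q \<mu> C)"

text \<open>
  The norm \<open>\<parallel>\<mu>\<parallel>\<close> of the embedding; it is \<open>\<infinity>\<close> exactly when the embedding is not bounded.
\<close>

definition fc_norm ::
    "real \<Rightarrow> nat \<Rightarrow> real \<Rightarrow> (complex ^ 'n::finite) measure \<Rightarrow> ennreal" where
  "fc_norm \<alpha> m q \<mu> = Inf {C. fc_bound \<alpha> m q \<mu> C}"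

definition vanishing_fock_carleson ::
    "real \<Rightarrow> nat \<Rightarrow> real \<Rightarrow> (complex ^ 'n::finite) measure \<Rightarrow> bool" where
  "vanishing_fock_carleson \<alpha> m q \<mu> \<longleftrightarrow>
     (\<forall>f :: nat \<Rightarrow> complex ^ 'n \<Rightarrow> complex.
        (\<forall>j. f j \<in> fock_sobolev \<alpha> m) \<longrightarrow>
        (SUP j. fs_norm \<alpha> m (f j)) < \<infinity> \<longrightarrow>
        (\<forall>K. compact K \<longrightarrow> uniform_limit K f (\<lambda>_. 0) sequentially) \<longrightarrow>
        (\<lambda>j. fc_integral \<alpha> q \<mu> (f j)) \<longlonglongrightarrow> 0)"

section \<open>Weighted measures, Berezin type transforms and averages\<close>

definition weighted_measure ::
    "real \<Rightarrow> (complex ^ 'n::finite) measure \<Rightarrow> (complex ^ 'n) measure" where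
  "weighted_measure s \<mu> = density \<mu> (\<lambda>z. ennreal ((1 + norm z) powr (- s)))"

definition berezin ::
    "real \<Rightarrow> real \<Rightarrow> real \<Rightarrow> (complex ^ 'n::finite) measure \<Rightarrow> complex ^ 'n \<Rightarrow> ennreal" where
  "berezin \<alpha> t s \<mu> w =
     (\<integral>\<^sup>+ z. ennreal ((1 + norm z) powr (- s) * exp (- (t * \<alpha> / 2) * (norm (z - w))\<^sup>2)) \<partial>\<mu>)"

definition averaged ::
    "real \<Rightarrow> real \<Rightarrow> (complex ^ 'n::finite) measure \<Rightarrow> complex ^ 'n \<Rightarrow> ennreal" where
  "averaged s r \<mu> z = emeasure \<mu> (ball z r) / ennreal ((1 + norm z) powr s)"

definition L1_norm :: "(complex ^ 'n::finite \<Rightarrow> ennreal) \<Rightarrow> ennreal" where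
  "L1_norm g = (\<integral>\<^sup>+ z. g z \<partial>lborel)"

definition in_L1 :: "(complex ^ 'n::finite \<Rightarrow> ennreal) \<Rightarrow> bool" where
  "in_L1 g \<longleftrightarrow> g \<in> borel_measurable lborel \<and> L1_norm g < \<infinity>"

text \<open>The radius \<open>r\<close> is that of the covering balls, so this describes an \<open>r/2\<close>-lattice.\<close>

definition half_lattice :: "real \<Rightarrow> (nat \<Rightarrow> complex ^ 'n::finite) \<Rightarrow> bool" where
  "half_lattice r z \<longleftrightarrow>
     inj z \<and> (\<Union>k. ball (z k) r) = UNIV \<and> disjoint_family (\<lambda>k. ball (z k) (r / 2))"

text \<open>
  The relation \<open>U \<simeq> V\<close> between two quantities in \<open>[0, \<infinity>]\<close> depending on a Borel measure \<open>\<mu>\<close>.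
\<close>

definition comparable ::
    "((complex ^ 'n::finite) measure \<Rightarrow> ennreal) \<Rightarrow> ((complex ^ 'n) measure \<Rightarrow> ennreal) \<Rightarrow> bool" where
  "comparable U V \<longleftrightarrow>
     (\<exists>C::real. C > 0 \<and>
        (\<forall>\<mu>. sets \<mu> = sets borel \<longrightarrow> U \<mu> \<le> ennreal C * V \<mu> \<and> V \<mu> \<le> ennreal C * U \<mu>))"

end

theory Submission
  imports Defs "HOL-Complex_Analysis.Conformal_Mappings" "HOL-Probability.Distributions"
begin

text \<open>
  Write \<open>\<nu>\<close> for the weighted measure \<open>d\<nu> = (1 + |z|)\<^sup>-\<^sup>m\<^sup>q d\<mu>\<close>. Every quantity in the theorem is comparable
  to the total mass \<open>\<nu>(\<complex>\<^sup>n)\<close>, and both Carleson properties are equivalent to its finiteness; so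
  \<open>\<nu>(\<complex>\<^sup>n)\<close> is the hub through which all statements are compared.

  Averages and Berezin transforms. On a ball of fixed radius the weight \<open>(1 + |z|)\<^sup>s\<close> changes at most by
  a constant factor, so \<open>\<mu>(D(w,r)) / (1 + |w|)\<^sup>s\<close> is comparable to \<open>\<nu>(D(w,r))\<close>, and the Berezin
  transform is the integral of a Gaussian against \<open>\<nu>\<close>. One estimate does the rest: for a lattice
  \<open>(z\<^sub>k)\<close> and \<open>a > 0\<close> the sums \<open>\<Sum>\<^sub>k exp (- a |w - z\<^sub>k|\<^sup>2)\<close> are bounded uniformly in \<open>w\<close>
  (\<open>gaussian_lattice_sum_bounded\<close>). It bounds the overlap of the balls \<open>D(z\<^sub>k,r)\<close> and, after
  discretising the integral over \<open>w\<close> along a lattice, the \<open>L\<^sup>1\<close> norms by the mass. Conversely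
  the mass is at most the sum over a covering by small balls, which is at most the integral of
  \<open>\<nu>(D(w,r))\<close>. Since \<open>\<mu>\<close> need not be sigma-finite, Tonelli's theorem does not apply; only integrals
  of countable sums are interchanged.

  The mass bounds the embedding. The maximum principle on a complex line through the origin replaces
  \<open>|z|\<^sup>m\<close> by \<open>(1 + |z|)\<^sup>m\<close> in the norm (\<open>weighted_sup_le_fs_norm\<close>), whence
  \<open>|f|\<^sup>q exp (- \<alpha> q |z|\<^sup>2 / 2) \<le> const * \<parallel>f\<parallel>\<^sup>q (1 + |z|)\<^sup>-\<^sup>m\<^sup>q\<close>. Integrating this gives the Carleson
  inequality, and dominated convergence gives the vanishing property.

  The embedding bounds the mass (\<open>lattice_test_functions\<close>). Test on the finite sums
  \<open>\<Sum>\<^sub>k \<plusminus> (1 + |z\<^sub>k|)\<^sup>-\<^sup>m exp (\<alpha> \<langle>z, z\<^sub>k\<rangle> - \<alpha> |z\<^sub>k|\<^sup>2 / 2)\<close> over lattice points. The lattice estimate bounds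
  their norms independently of the signs and of the number of terms. For a fixed \<open>z\<close>, the average over
  all signs of the \<open>q\<close>-th power of the modulus is at least half the \<open>q\<close>-th power of the modulus of each
  single term (\<open>sum_signs_powr_ge\<close>, an elementary substitute for Khinchine's inequality), and near \<open>z\<^sub>k\<close>
  the term of index \<open>k\<close> is as large as the growth condition permits. Integrating the average against
  \<open>\<mu>\<close> bounds \<open>\<nu>\<close> on the union of finitely many lattice balls, uniformly in their number. If
  \<open>\<nu>(\<complex>\<^sup>n) = \<infinity>\<close>, suitably scaled test functions also contradict the vanishing property.
\<close>

section \<open>Gaussian sums over lattices\<close>

lemma gaussian_nn_integral_finite:
  fixes a :: real
  assumes "a > 0"
  shows "(\<integral>\<^sup>+ u. ennreal (exp (- a * (norm (u :: 'a::euclidean_space))\<^sup>2)) \<partial>lborel) < \<infinity>"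
proof -
  \<comment> \<open>The standard deviation for which the normal density is proportional to \<open>exp (- a x\<^sup>2)\<close>.\<close>
  define \<sigma> where "\<sigma> = 1 / sqrt (2 * a)"
  have \<sigma>: "\<sigma> > 0" "\<sigma>\<^sup>2 = 1 / (2 * a)"
    using assms by (auto simp: \<sigma>_def power_divide)
  have dens: "exp (- a * x\<^sup>2) = sqrt (2 * pi * \<sigma>\<^sup>2) * normal_density 0 \<sigma> x" for x
    using \<sigma> assms by (simp add: normal_density_def field_simps)
  have "integrable lborel (\<lambda>x. exp (- a * x\<^sup>2))"
    unfolding dens using integrable_normal_density[OF \<sigma>(1), of 0] by auto
  then have one_dim: "(\<integral>\<^sup>+ x. ennreal (exp (- a * x\<^sup>2)) \<partial>lborel) < \<infinity>"
    by (simp add: nn_integral_eq_integral)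
  have "ennreal (exp (- a * (norm u)\<^sup>2)) = (\<Prod>b\<in>Basis. ennreal (exp (- a * (u \<bullet> b)\<^sup>2)))"
    for u :: 'a
  proof -
    have "(norm u)\<^sup>2 = (\<Sum>b\<in>Basis. (u \<bullet> b)\<^sup>2)"
      unfolding power2_norm_eq_inner
      by (subst euclidean_inner) (simp add: power2_eq_square)
    then show ?thesis
      by (simp add: prod_ennreal sum_distrib_left exp_sum)
  qed
  then have "(\<integral>\<^sup>+ u. ennreal (exp (- a * (norm (u :: 'a))\<^sup>2)) \<partial>lborel)
      = (\<Prod>b\<in>(Basis :: 'a set). \<integral>\<^sup>+ x. ennreal (exp (- a * x\<^sup>2)) \<partial>lborel)"
    using nn_integral_lborel_prod[of "\<lambda>(_ :: 'a) x. ennreal (exp (- a * x\<^sup>2))"] by simp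
  then show ?thesis
    using one_dim by (simp add: power_less_top_ennreal)
qed

text \<open>
  Half of the Gaussian absorbs the polynomial factor, because \<open>(1 + x)\<^sup>m / m! \<le> exp (1 + x)\<close> and the
  exponent \<open>x\<close> is at most \<open>1 / (2 a) + a x\<^sup>2 / 2\<close>.
\<close>

lemma power_times_gaussian_le:
  fixes a x :: real
  assumes "a > 0" "x \<ge> 0"
  shows "(1 + x) ^ m * exp (- a * x\<^sup>2) \<le> fact m * exp (1 + 1 / (2 * a)) * exp (- (a / 2) * x\<^sup>2)"
proof -
  have "(\<lambda>n. (1 + x) ^ n / fact n) sums exp (1 + x)"
    using exp_converges[of "1 + x"] by (simp add: divide_inverse mult.commute)
  then have "(1 + x) ^ m / fact m \<le> exp (1 + x)"
    using assms sum_le_suminf[of "\<lambda>n. (1 + x) ^ n / fact n" "{m}"] by (auto simp: sums_iff)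
  also have "\<dots> \<le> exp (1 + 1 / (2 * a) + (a / 2) * x\<^sup>2)"
  proof -
    \<comment> \<open>Completing the square in \<open>x \<le> 1 / (2 a) + a x\<^sup>2 / 2\<close>.\<close>
    have "0 \<le> (a * x - 1)\<^sup>2 / (2 * a)"
      using assms by simp
    also have "\<dots> = 1 / (2 * a) + (a / 2) * x\<^sup>2 - x"
      using assms by (simp add: power2_eq_square field_simps)
    finally show ?thesis by simp
  qed
  finally have "(1 + x) ^ m \<le> fact m * exp (1 + 1 / (2 * a) + (a / 2) * x\<^sup>2)"
    by (simp add: field_simps)
  then have "(1 + x) ^ m * exp (- a * x\<^sup>2)
      \<le> fact m * exp (1 + 1 / (2 * a) + (a / 2) * x\<^sup>2) * exp (- a * x\<^sup>2)"
    by (rule mult_right_mono) simp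
  also have "\<dots> = fact m * exp (1 + 1 / (2 * a)) * exp (- (a / 2) * x\<^sup>2)"
    by (simp add: mult.assoc flip: exp_add)
  finally show ?thesis .
qed

lemma pred_mem_ball [measurable]:
  fixes c :: "'a::metric_space"
  shows "Measurable.pred borel (\<lambda>x. x \<in> ball c r)"
  by (simp add: pred_def del: mem_ball)

lemma half_lattice_pos:
  assumes "half_lattice r z" shows "r > 0"
proof (rule ccontr)
  assume "\<not> r > 0"
  then have "(\<Union>k. ball (z k) r) = {}" by (auto simp: not_less)
  with assms show False by (simp add: half_lattice_def)
qed

lemma norm_diff_sq_le:
  fixes x y z :: "'a::real_inner"
  shows "(norm (x - y))\<^sup>2 \<le> 2 * (norm (x - z))\<^sup>2 + 2 * (norm (z - y))\<^sup>2"
proof -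
  have "norm (x - y) \<le> norm (x - z) + norm (z - y)"
    using norm_triangle_ineq[of "x - z" "z - y"] by simp
  then have "(norm (x - y))\<^sup>2 \<le> (norm (x - z) + norm (z - y))\<^sup>2"
    by (rule power_mono) simp
  also have "\<dots> \<le> 2 * (norm (x - z))\<^sup>2 + 2 * (norm (z - y))\<^sup>2"
    using sum_squares_bound[of "norm (x - z)" "norm (z - y)"] by (simp add: power2_sum)
  finally show ?thesis .
qed

text \<open>
  The term of index \<open>k\<close> is at most a constant times the integral of a wider Gaussian over the ball of
  radius \<open>r / 2\<close> about \<open>z\<^sub>k\<close>. These balls are disjoint, so the sum is bounded by the integral of that
  Gaussian over the whole space, which does not depend on its centre \<open>w\<close>.
\<close>

lemma gaussian_lattice_sum_bounded:
  fixes z :: "nat \<Rightarrow> complex ^ 'n::finite"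
  assumes lat: "half_lattice r z" and "a > 0"
  obtains A where "A > 0"
    "\<And>w. (\<Sum>k. ennreal (exp (- a * (norm (w - z k))\<^sup>2))) \<le> ennreal A"
proof -
  have r: "r > 0" using half_lattice_pos[OF lat] .
  have disj: "disjoint_family (\<lambda>k. ball (z k) (r / 2))"
    using lat by (simp add: half_lattice_def)
  define V where "V = unit_ball_vol DIM(complex ^ 'n) * (r / 2) ^ DIM(complex ^ 'n)"
  have V: "V > 0"
    unfolding V_def by (intro mult_pos_pos unit_ball_vol_pos zero_less_power) (use r in auto)
  have vol: "emeasure lborel (ball x (r / 2)) = ennreal V" for x :: "complex ^ 'n"
    unfolding V_def by (rule emeasure_ball) (use r in simp)
  \<comment> \<open>The factor \<open>exp (a r\<^sup>2 / 4)\<close> pays for moving the centre by at most \<open>r / 2\<close> inside the ball.\<close>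
  define c where "c = exp (a * r\<^sup>2 / 4) / V"
  define g where "g w u = ennreal (exp (- (a / 2) * (norm (u - w))\<^sup>2))" for w u :: "complex ^ 'n"
  have g_meas [measurable]: "g w \<in> borel_measurable borel" for w
    unfolding g_def by measurable
  define I where "I = (\<integral>\<^sup>+ u. g 0 u \<partial>lborel)"
  have I: "I < \<infinity>"
    using gaussian_nn_integral_finite[of "a/2"] \<open>a > 0\<close> by (simp add: I_def g_def)
  have transl: "(\<integral>\<^sup>+ u. g w u \<partial>lborel) = I" for w
    by (subst lborel_distr_plus[of w, symmetric]) (simp add: nn_integral_distr I_def g_def)
  have each: "ennreal (exp (- a * (norm (w - z k))\<^sup>2))
      \<le> ennreal c * (\<integral>\<^sup>+ u. indicator (ball (z k) (r / 2)) u * g w u \<partial>lborel)" for w k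
  proof -
    have "ennreal (exp (- a * (norm (w - z k))\<^sup>2)) =
        ennreal c * (ennreal (exp (- (a * r\<^sup>2 / 4)) * exp (- a * (norm (w - z k))\<^sup>2)) * ennreal V)"
      using V unfolding c_def
      by (simp add: exp_minus field_simps flip: ennreal_mult)
    also have "\<dots> = ennreal c * (\<integral>\<^sup>+ u. ennreal (exp (- (a * r\<^sup>2 / 4)) * exp (- a * (norm (w - z k))\<^sup>2))
         * indicator (ball (z k) (r / 2)) u \<partial>lborel)"
      by (subst nn_integral_cmult_indicator) (auto simp: vol)
    also have "\<dots> \<le> ennreal c * (\<integral>\<^sup>+ u. indicator (ball (z k) (r / 2)) u * g w u \<partial>lborel)"
    proof (intro mult_left_mono nn_integral_mono)
      fix u
      show "ennreal (exp (- (a * r\<^sup>2 / 4)) * exp (- a * (norm (w - z k))\<^sup>2))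
          * indicator (ball (z k) (r / 2)) u \<le> indicator (ball (z k) (r / 2)) u * g w u"
      proof (cases "u \<in> ball (z k) (r / 2)")
        case True
        then have "(norm (z k - u))\<^sup>2 \<le> (r / 2)\<^sup>2"
          using r by (intro power_mono) (auto simp: dist_norm)
        then have "(norm (u - w))\<^sup>2 \<le> 2 * (norm (w - z k))\<^sup>2 + r\<^sup>2 / 2"
          using norm_diff_sq_le[of w u "z k"] by (simp add: power_divide norm_minus_commute)
        from mult_left_mono[OF this, of "a / 2"]
        have "exp (- (a * r\<^sup>2 / 4)) * exp (- a * (norm (w - z k))\<^sup>2) \<le> exp (- (a / 2) * (norm (u - w))\<^sup>2)"
          using \<open>a > 0\<close> by (simp add: algebra_simps flip: exp_add)
        then show ?thesis using True by (simp add: g_def ennreal_leI)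
      qed auto
    qed auto
    finally show ?thesis .
  qed
  have ind1: "(\<Sum>k. indicator (ball (z k) (r / 2)) u) \<le> (1 :: ennreal)" for u
    unfolding suminf_indicator[OF disj] by (simp add: indicator_def)
  have "(\<Sum>k. ennreal (exp (- a * (norm (w - z k))\<^sup>2))) \<le> ennreal c * I" for w
  proof -
    have "(\<Sum>k. ennreal (exp (- a * (norm (w - z k))\<^sup>2)))
        \<le> (\<Sum>k. ennreal c * (\<integral>\<^sup>+ u. indicator (ball (z k) (r / 2)) u * g w u \<partial>lborel))"
      by (intro suminf_le each) auto
    also have "\<dots> = ennreal c * (\<integral>\<^sup>+ u. (\<Sum>k. indicator (ball (z k) (r / 2)) u) * g w u \<partial>lborel)"
      unfolding ennreal_suminf_cmult ennreal_suminf_multc[symmetric]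
      by (subst nn_integral_suminf) (auto intro!: borel_measurable_times_ennreal borel_measurable_indicator)
    also have "\<dots> \<le> ennreal c * (\<integral>\<^sup>+ u. 1 * g w u \<partial>lborel)"
      by (intro mult_left_mono nn_integral_mono mult_right_mono ind1) auto
    finally show ?thesis by (simp add: transl)
  qed
  \<comment> \<open>Adding \<open>1\<close> makes the real bound positive.\<close>
  moreover have "ennreal c * I \<le> ennreal (enn2real (ennreal c * I) + 1)"
    using I by (simp add: ennreal_mult_less_top ennreal_plus)
  ultimately show thesis
    by (intro that[of "enn2real (ennreal c * I) + 1"]) (auto intro: order.trans simp: add_nonneg_pos)
qed

text \<open>
  By Zorn's lemma there is a maximal set of points with mutual distances at least \<open>r\<close>. Maximality
  says that the balls of radius \<open>r\<close> cover the space. The set is countable because it carries disjoint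
  nonempty open balls, and infinite because finitely many balls do not cover an unbounded space.
\<close>

lemma half_lattice_exists:
  assumes "r > 0"
  obtains z :: "nat \<Rightarrow> complex ^ 'n::finite" where "half_lattice r z"
proof -
  define \<A> where "\<A> = {S :: (complex ^ 'n) set. \<forall>x\<in>S. \<forall>y\<in>S. x \<noteq> y \<longrightarrow> r \<le> dist x y}"
  have "\<Union>C \<in> \<A>" if "subset.chain \<A> C" for C
    unfolding \<A>_def
  proof clarify
    fix x y X Y assume xy: "x \<in> X" "X \<in> C" "y \<in> Y" "Y \<in> C" "x \<noteq> y"
    then have "X \<subseteq> Y \<or> Y \<subseteq> X"
      using that by (auto simp: subset.chain_def)
    then consider "X \<subseteq> Y" | "Y \<subseteq> X" by blast
    then show "r \<le> dist x y"
      using xy that by cases (auto simp: subset.chain_def \<A>_def subset_iff)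
  qed
  then obtain M where M: "M \<in> \<A>" and max: "\<And>X. X \<in> \<A> \<Longrightarrow> M \<subseteq> X \<Longrightarrow> X = M"
    using subset_Zorn'[of \<A>] by auto
  have sep: "r \<le> dist x y" if "x \<in> M" "y \<in> M" "x \<noteq> y" for x y
    using M that by (auto simp: \<A>_def)
  have cover: "\<exists>y\<in>M. dist y x < r" for x
  proof (rule ccontr)
    assume far: "\<not> (\<exists>y\<in>M. dist y x < r)"
    then have "insert x M \<in> \<A>"
      using sep by (auto simp: \<A>_def not_less dist_commute)
    then have "x \<in> M" using max[of "insert x M"] by auto
    with far assms show False by auto
  qed
  have disj: "ball x (r / 2) \<inter> ball y (r / 2) = {}" if "x \<in> M" "y \<in> M" "x \<noteq> y" for x y
    using sep[OF that] by (intro disjoint_ballI) auto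
  have inj: "inj_on (\<lambda>x. ball x (r / 2)) M"
  proof (rule inj_onI, rule ccontr)
    fix x y assume "x \<in> M" "y \<in> M" "ball x (r / 2) = ball y (r / 2)" "x \<noteq> y"
    then have "ball x (r / 2) = {}" using disj[of x y] by simp
    with assms show False by simp
  qed
  have "countable ((\<lambda>x. ball x (r / 2)) ` M)"
    by (rule countable_disjoint_open_subsets) (use disj in \<open>auto simp: pairwise_def disjnt_def\<close>)
  then have count: "countable M"
    using inj by (rule countable_image_inj_on)
  have inf: "infinite M"
  proof
    assume "finite M"
    then have "bounded (\<Union>x\<in>M. ball x r)" by auto
    moreover have "(\<Union>x\<in>M. ball x r) = UNIV" using cover by (auto simp: set_eq_iff)
    ultimately show False using not_bounded_UNIV[where 'a = "complex ^ 'n"] by simp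
  qed
  define z where "z = from_nat_into M"
  have bij: "bij_betw z UNIV M"
    unfolding z_def using count inf by (rule bij_betw_from_nat_into)
  then have "inj z" and rng: "range z = M"
    by (auto simp: bij_betw_def)
  moreover have "(\<Union>k. ball (z k) r) = UNIV"
  proof -
    have "\<exists>k. x \<in> ball (z k) r" for x
    proof -
      from cover obtain y where "y \<in> M" "dist y x < r" by blast
      moreover from \<open>y \<in> M\<close> obtain k where "y = z k" using rng by blast
      ultimately show ?thesis by auto
    qed
    then show ?thesis by blast
  qed
  moreover have "disjoint_family (\<lambda>k. ball (z k) (r / 2))"
    unfolding disjoint_family_on_def using disj rng \<open>inj z\<close> by (auto dest: injD)
  ultimately have "half_lattice r z"
    by (simp add: half_lattice_def)
  then show thesis by (rule that)
qed

section \<open>Total mass, ball averages and Gaussian transforms\<close>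

lemma emeasure_le_lattice_sum:
  fixes z :: "nat \<Rightarrow> complex ^ 'n::finite"
  assumes lat: "half_lattice r z" and sets: "sets \<nu> = sets borel"
  shows "emeasure \<nu> UNIV \<le> (\<Sum>k. emeasure \<nu> (ball (z k) r))"
proof -
  have "(\<Union>k. ball (z k) r) = UNIV"
    using lat by (simp add: half_lattice_def)
  moreover have "emeasure \<nu> (\<Union>k. ball (z k) r) \<le> (\<Sum>k. emeasure \<nu> (ball (z k) r))"
    by (rule emeasure_subadditive_countably) (auto simp: sets)
  ultimately show ?thesis by simp
qed

text \<open>
  The overlap of the balls is bounded: the indicator of the ball about \<open>z\<^sub>k\<close> is at most
  \<open>exp (R\<^sup>2) * exp (- |w - z\<^sub>k|\<^sup>2)\<close>, whose sum over \<open>k\<close> is a bounded function of \<open>w\<close>.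
\<close>

lemma lattice_sum_le_emeasure:
  fixes z :: "nat \<Rightarrow> complex ^ 'n::finite"
  assumes lat: "half_lattice r z"
  obtains C where "C > 0"
    "\<And>\<nu>. sets \<nu> = sets borel \<Longrightarrow> (\<Sum>k. emeasure \<nu> (ball (z k) R)) \<le> ennreal C * emeasure \<nu> UNIV"
proof -
  obtain A where A: "A > 0" "\<And>w. (\<Sum>k. ennreal (exp (- 1 * (norm (w - z k))\<^sup>2))) \<le> ennreal A"
    by (rule gaussian_lattice_sum_bounded[OF lat zero_less_one]) blast
  define C where "C = exp (R\<^sup>2) * A"
  have ind: "indicator (ball (z k) R) w \<le> ennreal (exp (R\<^sup>2)) * ennreal (exp (- 1 * (norm (w - z k))\<^sup>2))"
    for w k
  proof (cases "w \<in> ball (z k) R")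
    case True
    then have "(norm (w - z k))\<^sup>2 \<le> R\<^sup>2"
      by (intro power_mono) (auto simp: dist_norm norm_minus_commute)
    then have "1 \<le> exp (R\<^sup>2) * exp (- 1 * (norm (w - z k))\<^sup>2)"
      by (simp flip: exp_add)
    from ennreal_leI[OF this]
    have "1 \<le> ennreal (exp (R\<^sup>2) * exp (- 1 * (norm (w - z k))\<^sup>2))" by simp
    then show ?thesis using True by (simp add: ennreal_mult)
  qed auto
  have overlap: "(\<Sum>k. indicator (ball (z k) R) w) \<le> ennreal C" for w
  proof -
    have "(\<Sum>k. indicator (ball (z k) R) w)
        \<le> (\<Sum>k. ennreal (exp (R\<^sup>2)) * ennreal (exp (- 1 * (norm (w - z k))\<^sup>2)))"
      by (intro suminf_le ind) auto
    also have "\<dots> \<le> ennreal (exp (R\<^sup>2)) * ennreal A"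
      unfolding ennreal_suminf_cmult by (intro mult_left_mono A) auto
    finally show ?thesis using A(1) by (simp add: C_def ennreal_mult)
  qed
  have "(\<Sum>k. emeasure \<nu> (ball (z k) R)) \<le> ennreal C * emeasure \<nu> UNIV"
    if sets: "sets \<nu> = sets borel" for \<nu> :: "(complex ^ 'n) measure"
  proof -
    have [simp]: "space \<nu> = UNIV" using sets_eq_imp_space_eq[OF sets] by simp
    have [measurable_cong]: "sets \<nu> = sets borel" by (rule sets)
    have "(\<Sum>k. emeasure \<nu> (ball (z k) R)) = (\<Sum>k. \<integral>\<^sup>+ w. indicator (ball (z k) R) w \<partial>\<nu>)"
      by (intro suminf_cong nn_integral_indicator[symmetric]) (simp add: sets)
    also have "\<dots> = (\<integral>\<^sup>+ w. (\<Sum>k. indicator (ball (z k) R) w) \<partial>\<nu>)"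
      by (rule nn_integral_suminf[symmetric]) measurable
    also have "\<dots> \<le> (\<integral>\<^sup>+ w. ennreal C \<partial>\<nu>)"
      by (intro nn_integral_mono overlap)
    finally show ?thesis by simp
  qed
  moreover have "C > 0" using A by (simp add: C_def)
  ultimately show thesis by (intro that)
qed

text \<open>
  For \<open>w\<close> in the unit ball about a lattice point \<open>p\<^sub>k\<close>, the Gaussian centred at \<open>w\<close> is at most a multiple
  of a wider Gaussian centred at \<open>p\<^sub>k\<close>. This replaces the integral over \<open>w\<close> by a sum over \<open>k\<close>, which may be
  interchanged with the integral against an arbitrary measure \<open>\<nu>\<close>.
\<close>

lemma gaussian_transform_L1_le:
  assumes "b > 0"
  obtains C where "C > 0"
    "\<And>\<nu> :: (complex ^ 'n::finite) measure. sets \<nu> = sets borel \<Longrightarrow>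
       (\<integral>\<^sup>+ w. \<integral>\<^sup>+ z. ennreal (exp (- b * (norm (z - w))\<^sup>2)) \<partial>\<nu> \<partial>lborel) \<le> ennreal C * emeasure \<nu> UNIV"
proof -
  obtain p :: "nat \<Rightarrow> complex ^ 'n" where lat: "half_lattice 1 p"
    by (rule half_lattice_exists[OF zero_less_one])
  obtain A where A: "A > 0" "\<And>w. (\<Sum>k. ennreal (exp (- (b / 2) * (norm (w - p k))\<^sup>2))) \<le> ennreal A"
    by (rule gaussian_lattice_sum_bounded[OF lat half_gt_zero[OF \<open>b > 0\<close>]]) blast
  define V where "V = unit_ball_vol DIM(complex ^ 'n)"
  have V: "V > 0" and vol: "emeasure lborel (ball x 1) = ennreal V" for x :: "complex ^ 'n"
    by (auto simp: V_def emeasure_ball)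
  define h where "h k z = ennreal (exp b) * ennreal (exp (- (b / 2) * (norm (z - p k))\<^sup>2))" for k z
  have [measurable]: "h k \<in> borel_measurable borel" for k
    unfolding h_def by measurable
  have term_le: "F k \<le> suminf F" for F :: "nat \<Rightarrow> ennreal" and k
    using sum_le_suminf[of F "{k}"] by simp
  have pt: "ennreal (exp (- b * (norm (z - w))\<^sup>2)) \<le> (\<Sum>k. indicator (ball (p k) 1) w * h k z)" for z w
  proof -
    have "w \<in> (\<Union>k. ball (p k) 1)"
      using lat by (simp add: half_lattice_def)
    then obtain k where k: "w \<in> ball (p k) 1" by blast
    then have "(norm (w - p k))\<^sup>2 \<le> 1\<^sup>2"
      by (intro power_mono) (auto simp: dist_norm norm_minus_commute)
    then have "(norm (z - p k))\<^sup>2 \<le> 2 * (norm (z - w))\<^sup>2 + 2"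
      using norm_diff_sq_le[of z "p k" w] by simp
    from mult_left_mono[OF this, of "b / 2"]
    have "exp (- b * (norm (z - w))\<^sup>2) \<le> exp b * exp (- (b / 2) * (norm (z - p k))\<^sup>2)"
      using \<open>b > 0\<close> by (simp add: algebra_simps flip: exp_add)
    then have "ennreal (exp (- b * (norm (z - w))\<^sup>2)) \<le> indicator (ball (p k) 1) w * h k z"
      using k by (simp add: h_def ennreal_leI flip: ennreal_mult)
    also have "\<dots> \<le> (\<Sum>k. indicator (ball (p k) 1) w * h k z)"
      by (rule term_le)
    finally show ?thesis .
  qed
  define C where "C = V * (exp b * A)"
  have "(\<integral>\<^sup>+ w. \<integral>\<^sup>+ z. ennreal (exp (- b * (norm (z - w))\<^sup>2)) \<partial>\<nu> \<partial>lborel) \<le> ennreal C * emeasure \<nu> UNIV"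
    if sets: "sets \<nu> = sets borel" for \<nu> :: "(complex ^ 'n) measure"
  proof -
    have [simp]: "space \<nu> = UNIV" using sets_eq_imp_space_eq[OF sets] by simp
    have [measurable_cong]: "sets \<nu> = sets borel" by (rule sets)
    have "(\<integral>\<^sup>+ w. \<integral>\<^sup>+ z. ennreal (exp (- b * (norm (z - w))\<^sup>2)) \<partial>\<nu> \<partial>lborel)
        \<le> (\<integral>\<^sup>+ w. \<integral>\<^sup>+ z. (\<Sum>k. indicator (ball (p k) 1) w * h k z) \<partial>\<nu> \<partial>lborel)"
      by (intro nn_integral_mono pt)
    also have "\<dots> = (\<integral>\<^sup>+ w. (\<Sum>k. indicator (ball (p k) 1) w * (\<integral>\<^sup>+ z. h k z \<partial>\<nu>)) \<partial>lborel)"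
      by (simp add: nn_integral_suminf nn_integral_cmult)
    also have "\<dots> = (\<Sum>k. ennreal V * (\<integral>\<^sup>+ z. h k z \<partial>\<nu>))"
      by (subst nn_integral_suminf) (simp_all add: nn_integral_multc vol)
    also have "\<dots> = ennreal V * (\<integral>\<^sup>+ z. (\<Sum>k. h k z) \<partial>\<nu>)"
      by (simp add: nn_integral_suminf)
    also have "\<dots> \<le> ennreal V * (\<integral>\<^sup>+ z. ennreal (exp b) * ennreal A \<partial>\<nu>)"
      unfolding h_def ennreal_suminf_cmult by (intro mult_left_mono nn_integral_mono A) auto
    also have "\<dots> = ennreal C * emeasure \<nu> UNIV"
      using V A(1) by (simp add: C_def ennreal_mult mult.assoc)
    finally show ?thesis .
  qed
  moreover have "C > 0" using V A(1) by (simp add: C_def)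
  ultimately show thesis by (intro that)
qed

text \<open>
  The balls of radius \<open>r / 2\<close> about an \<open>r / 4\<close>-lattice cover the space, and each of them lies in the ball
  of radius \<open>r\<close> about any point \<open>w\<close> within \<open>r / 4\<close> of its centre. As the balls of radius \<open>r / 4\<close> are
  disjoint, the masses of the covering balls add up to at most a multiple of the integral.
\<close>

lemma emeasure_le_ball_average_L1:
  assumes "r > 0"
  obtains C where "C > 0"
    "\<And>\<nu> :: (complex ^ 'n::finite) measure. sets \<nu> = sets borel \<Longrightarrow>
       emeasure \<nu> UNIV \<le> ennreal C * (\<integral>\<^sup>+ w. emeasure \<nu> (ball w r) \<partial>lborel)"
proof -
  obtain p :: "nat \<Rightarrow> complex ^ 'n" where lat: "half_lattice (r / 2) p"
    by (rule half_lattice_exists[OF half_gt_zero[OF \<open>r > 0\<close>]])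
  have disj: "disjoint_family (\<lambda>k. ball (p k) (r / 4))"
    using lat by (simp add: half_lattice_def)
  define V where "V = unit_ball_vol DIM(complex ^ 'n) * (r / 4) ^ DIM(complex ^ 'n)"
  have V: "V > 0"
    unfolding V_def by (intro mult_pos_pos unit_ball_vol_pos zero_less_power) (use \<open>r > 0\<close> in auto)
  have vol: "emeasure lborel (ball x (r / 4)) = ennreal V" for x :: "complex ^ 'n"
    unfolding V_def by (rule emeasure_ball) (use \<open>r > 0\<close> in simp)
  have "emeasure \<nu> UNIV \<le> ennreal (1 / V) * (\<integral>\<^sup>+ w. emeasure \<nu> (ball w r) \<partial>lborel)"
    if sets: "sets \<nu> = sets borel" for \<nu> :: "(complex ^ 'n) measure"
  proof -
    have pt: "(\<Sum>k. emeasure \<nu> (ball (p k) (r / 2)) * indicator (ball (p k) (r / 4)) w)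
        \<le> emeasure \<nu> (ball w r)" for w
    proof -
      have "emeasure \<nu> (ball (p k) (r / 2)) * indicator (ball (p k) (r / 4)) w
          \<le> emeasure \<nu> (ball w r) * indicator (ball (p k) (r / 4)) w" for k
      proof (cases "w \<in> ball (p k) (r / 4)")
        case True
        then have "ball (p k) (r / 2) \<subseteq> ball w r"
          using \<open>r > 0\<close> by (subst ball_subset_ball_iff) (auto simp: dist_commute)
        then show ?thesis using True by (auto intro!: emeasure_mono simp: sets)
      qed auto
      then have "(\<Sum>k. emeasure \<nu> (ball (p k) (r / 2)) * indicator (ball (p k) (r / 4)) w)
          \<le> (\<Sum>k. emeasure \<nu> (ball w r) * indicator (ball (p k) (r / 4)) w)"
        by (intro suminf_le) auto
      also have "\<dots> \<le> emeasure \<nu> (ball w r) * 1"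
        unfolding ennreal_suminf_cmult suminf_indicator[OF disj]
        by (intro mult_left_mono) (auto simp: indicator_def)
      finally show ?thesis by simp
    qed
    have "emeasure \<nu> UNIV \<le> (\<Sum>k. emeasure \<nu> (ball (p k) (r / 2)))"
      by (rule emeasure_le_lattice_sum[OF lat sets])
    also have "\<dots> = ennreal (1 / V) * (\<Sum>k. emeasure \<nu> (ball (p k) (r / 2)) * ennreal V)"
      using V by (simp add: ennreal_suminf_multc mult.left_commute[of "ennreal (1 / V)"] flip: ennreal_mult)
    also have "(\<Sum>k. emeasure \<nu> (ball (p k) (r / 2)) * ennreal V)
        = (\<integral>\<^sup>+ w. (\<Sum>k. emeasure \<nu> (ball (p k) (r / 2)) * indicator (ball (p k) (r / 4)) w) \<partial>lborel)"
      by (subst nn_integral_suminf)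
         (auto simp: nn_integral_cmult_indicator vol simp flip: ennreal_suminf_multc
           intro!: borel_measurable_times_ennreal borel_measurable_indicator)
    also have "ennreal (1 / V) * \<dots> \<le> ennreal (1 / V) * (\<integral>\<^sup>+ w. emeasure \<nu> (ball w r) \<partial>lborel)"
      by (intro mult_left_mono nn_integral_mono pt) auto
    finally show ?thesis .
  qed
  then show thesis using V by (intro that[of "1 / V"]) auto
qed

text \<open>
  The constant stands on the left, next to the mass of the ball, which is a measurable function of \<open>w\<close>:
  so it can be moved out of an integral over \<open>w\<close> for every Borel measure \<open>\<nu>\<close>.
\<close>

lemma emeasure_ball_le_gaussian_transform:
  fixes \<nu> :: "('a::euclidean_space) measure"
  assumes sets: "sets \<nu> = sets borel" and "b > 0"
  shows "ennreal (exp (- (b * r\<^sup>2))) * emeasure \<nu> (ball w r)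
     \<le> (\<integral>\<^sup>+ z. ennreal (exp (- b * (norm (z - w))\<^sup>2)) \<partial>\<nu>)"
proof -
  have [measurable_cong]: "sets \<nu> = sets borel" by (rule sets)
  have "ennreal (exp (- (b * r\<^sup>2))) * emeasure \<nu> (ball w r)
      = (\<integral>\<^sup>+ z. ennreal (exp (- (b * r\<^sup>2))) * indicator (ball w r) z \<partial>\<nu>)"
    by (simp add: sets nn_integral_cmult_indicator)
  also have "\<dots> \<le> (\<integral>\<^sup>+ z. ennreal (exp (- b * (norm (z - w))\<^sup>2)) \<partial>\<nu>)"
  proof (intro nn_integral_mono)
    fix z
    show "ennreal (exp (- (b * r\<^sup>2))) * indicator (ball w r) z \<le> ennreal (exp (- b * (norm (z - w))\<^sup>2))"
    proof (cases "z \<in> ball w r")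
      case True
      then have "(norm (z - w))\<^sup>2 \<le> r\<^sup>2"
        by (intro power_mono) (auto simp: dist_norm norm_minus_commute)
      then show ?thesis
        using True \<open>b > 0\<close> by (auto intro!: ennreal_leI mult_left_mono)
    qed auto
  qed
  finally show ?thesis .
qed

text \<open>
  The function is lower semicontinuous: by continuity from below, a strict lower bound for the mass of
  a ball holds already for a slightly smaller concentric ball, which is contained in the balls of the
  original radius about all nearby centres.
\<close>

lemma borel_measurable_emeasure_ball:
  fixes \<mu> :: "('a::euclidean_space) measure"
  assumes sets: "sets \<mu> = sets borel"
  shows "(\<lambda>x. emeasure \<mu> (ball x r)) \<in> borel_measurable borel"
proof (rule borel_measurableI_greater)
  fix y
  have "open {x. y < emeasure \<mu> (ball x r)}"
    unfolding open_contains_ball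
  proof clarify
    fix x assume y: "y < emeasure \<mu> (ball x r)"
    have "incseq (\<lambda>n. ball x (r - 1 / real (Suc n)))"
      by (intro monoI subset_ball diff_left_mono) (simp add: field_simps)
    then have "(SUP n. emeasure \<mu> (ball x (r - 1 / real (Suc n))))
        = emeasure \<mu> (\<Union>n. ball x (r - 1 / real (Suc n)))"
      by (intro SUP_emeasure_incseq) (auto simp: sets)
    also have "(\<Union>n. ball x (r - 1 / real (Suc n))) = ball x r"
    proof (intro equalityI subsetI)
      fix u assume "u \<in> ball x r"
      then obtain n where "1 / real (Suc n) < r - dist x u"
        using reals_Archimedean[of "r - dist x u"] by (auto simp: inverse_eq_divide)
      then show "u \<in> (\<Union>n. ball x (r - 1 / real (Suc n)))"
        by (intro UN_I[of n]) auto
    next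
      fix u assume "u \<in> (\<Union>n. ball x (r - 1 / real (Suc n)))"
      then obtain n where "dist x u < r - 1 / real (Suc n)" by auto
      moreover have "1 / real (Suc n) > 0" by simp
      ultimately have "dist x u < r" by linarith
      then show "u \<in> ball x r" by simp
    qed
    finally have "y < (SUP n. emeasure \<mu> (ball x (r - 1 / real (Suc n))))"
      using y by simp
    then obtain n where n: "y < emeasure \<mu> (ball x (r - 1 / real (Suc n)))"
      unfolding less_SUP_iff by blast
    have "ball x (1 / real (Suc n)) \<subseteq> {x. y < emeasure \<mu> (ball x r)}"
    proof clarify
      fix x' assume "x' \<in> ball x (1 / real (Suc n))"
      then have "ball x (r - 1 / real (Suc n)) \<subseteq> ball x' r"
        by (subst ball_subset_ball_iff) (auto simp: dist_commute)
      then have "emeasure \<mu> (ball x (r - 1 / real (Suc n))) \<le> emeasure \<mu> (ball x' r)"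
        by (intro emeasure_mono) (auto simp: sets)
      with n show "y < emeasure \<mu> (ball x' r)" by simp
    qed
    then show "\<exists>e>0. ball x e \<subseteq> {x. y < emeasure \<mu> (ball x r)}"
      by (intro exI[of _ "1 / real (Suc n)"]) auto
  qed
  then show "{x \<in> space borel. y < emeasure \<mu> (ball x r)} \<in> sets borel"
    by simp
qed

lemma ball_average_L1_le:
  fixes r :: real
  obtains C where "C > 0"
    "\<And>\<nu> :: (complex ^ 'n::finite) measure. sets \<nu> = sets borel \<Longrightarrow>
       (\<integral>\<^sup>+ w. emeasure \<nu> (ball w r) \<partial>lborel) \<le> ennreal C * emeasure \<nu> UNIV"
proof -
  obtain C where C: "C > 0" "\<And>\<nu> :: (complex ^ 'n) measure. sets \<nu> = sets borel \<Longrightarrow>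
       (\<integral>\<^sup>+ w. \<integral>\<^sup>+ z. ennreal (exp (- 1 * (norm (z - w))\<^sup>2)) \<partial>\<nu> \<partial>lborel) \<le> ennreal C * emeasure \<nu> UNIV"
    by (rule gaussian_transform_L1_le[OF zero_less_one]) blast
  have "(\<integral>\<^sup>+ w. emeasure \<nu> (ball w r) \<partial>lborel) \<le> ennreal (exp (r\<^sup>2) * C) * emeasure \<nu> UNIV"
    if sets: "sets \<nu> = sets borel" for \<nu> :: "(complex ^ 'n) measure"
  proof -
    have [measurable]: "(\<lambda>z. emeasure \<nu> (ball z r)) \<in> borel_measurable borel"
      using sets by (rule borel_measurable_emeasure_ball)
    have "(\<integral>\<^sup>+ w. emeasure \<nu> (ball w r) \<partial>lborel)
        = ennreal (exp (r\<^sup>2)) * (\<integral>\<^sup>+ w. ennreal (exp (- (1 * r\<^sup>2))) * emeasure \<nu> (ball w r) \<partial>lborel)"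
      by (simp add: nn_integral_cmult flip: mult.assoc ennreal_mult exp_add)
    also have "\<dots> \<le> ennreal (exp (r\<^sup>2)) * (\<integral>\<^sup>+ w. \<integral>\<^sup>+ z. ennreal (exp (- 1 * (norm (z - w))\<^sup>2)) \<partial>\<nu> \<partial>lborel)"
      by (intro mult_left_mono nn_integral_mono emeasure_ball_le_gaussian_transform sets) auto
    also have "\<dots> \<le> ennreal (exp (r\<^sup>2)) * (ennreal C * emeasure \<nu> UNIV)"
      by (intro mult_left_mono C(2) sets) auto
    finally show ?thesis
      using C(1) by (simp add: ennreal_mult mult.assoc)
  qed
  then show thesis
    using C(1) by (intro that[of "exp (r\<^sup>2) * C"]) auto
qed

section \<open>The weight and the averages of the measure\<close>

lemma one_plus_norm_le:
  fixes x y :: "'a::real_normed_vector"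
  shows "1 + norm x \<le> (1 + norm (x - y)) * (1 + norm y)"
proof -
  have "norm x \<le> norm (x - y) + norm y"
    using norm_triangle_ineq[of "x - y" y] by simp
  moreover have "0 \<le> norm (x - y) * norm y"
    by simp
  moreover have "(1 + norm (x - y)) * (1 + norm y) = 1 + norm (x - y) + norm y + norm (x - y) * norm y"
    by (simp add: algebra_simps)
  ultimately show ?thesis by linarith
qed

lemma weight_comparison:
  fixes z w :: "'a::real_normed_vector"
  assumes "s \<ge> 0" "norm (z - w) \<le> r"
  shows "(1 + norm z) powr s \<le> (1 + r) powr s * (1 + norm w) powr s"
proof -
  have "1 + norm z \<le> (1 + norm (z - w)) * (1 + norm w)"
    by (rule one_plus_norm_le)
  also have "\<dots> \<le> (1 + r) * (1 + norm w)"
    using assms(2) by (intro mult_right_mono) auto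
  finally have "(1 + norm z) powr s \<le> ((1 + r) * (1 + norm w)) powr s"
    using assms(1) by (intro powr_mono2) auto
  then show ?thesis by (simp add: powr_mult)
qed

lemma sets_weighted_measure [simp]:
  "sets \<mu> = sets borel \<Longrightarrow> sets (weighted_measure s \<mu>) = sets borel"
  by (simp add: weighted_measure_def)

lemma emeasure_weighted_measure_UNIV:
  assumes sets: "sets \<mu> = sets borel"
  shows "emeasure (weighted_measure s \<mu>) UNIV = (\<integral>\<^sup>+ z. ennreal ((1 + norm z) powr - s) \<partial>\<mu>)"
proof -
  have [measurable_cong]: "sets \<mu> = sets borel" by (rule sets)
  show ?thesis
    using sets_eq_imp_space_eq[OF sets]
    unfolding weighted_measure_def by (subst emeasure_density) (auto simp: sets)
qed

text \<open>
  On the ball of radius \<open>r\<close> about \<open>w\<close> the weight differs from its value at \<open>w\<close> by a factor of at most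
  \<open>(1 + r)\<^sup>s\<close> in either direction.
\<close>

lemma averaged_bounds:
  fixes w :: "complex ^ 'n::finite"
  assumes sets: "sets \<mu> = sets borel" and "s \<ge> 0" "r > 0"
  shows "averaged s r \<mu> w \<le> ennreal ((1 + r) powr s) * emeasure (weighted_measure s \<mu>) (ball w r)"
    and "emeasure (weighted_measure s \<mu>) (ball w r) \<le> ennreal ((1 + r) powr s) * averaged s r \<mu> w"
proof -
  have [measurable_cong]: "sets \<mu> = sets borel" by (rule sets)
  define c where "c = (1 + r) powr s"
  have c: "c > 0" using \<open>r > 0\<close> by (simp add: c_def)
  have pos: "0 < (1 + norm u) powr s" for u :: "complex ^ 'n"
    using norm_ge_zero[of u] by (simp add: add_nonneg_eq_0_iff)
  have avg: "averaged s r \<mu> w = ennreal ((1 + norm w) powr - s) * emeasure \<mu> (ball w r)"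
    using inverse_ennreal[OF pos[of w]]
    by (simp add: averaged_def divide_ennreal_def powr_minus mult.commute)
  have wt: "emeasure (weighted_measure s \<mu>) (ball w r)
      = (\<integral>\<^sup>+ z. ennreal ((1 + norm z) powr - s) * indicator (ball w r) z \<partial>\<mu>)"
    unfolding weighted_measure_def by (rule emeasure_density) (auto simp: sets)
  have inverses: "(1 + norm u) powr - s \<le> c * (1 + norm v) powr - s"
    if "norm (u - v) < r" for u v :: "complex ^ 'n"
  proof -
    have "(1 + norm v) powr s \<le> c * (1 + norm u) powr s"
      using weight_comparison[of s v u r] that assms(2) by (simp add: c_def norm_minus_commute)
    then show ?thesis
      using pos[of u] pos[of v] by (simp add: powr_minus field_simps)
  qed
  have cst: "(\<integral>\<^sup>+ z. ennreal (x * (1 + norm w) powr - s) * indicator (ball w r) z \<partial>\<mu>)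
      = ennreal x * averaged s r \<mu> w" if "x > 0" for x
    using that unfolding avg by (subst nn_integral_cmult_indicator) (auto simp: sets ennreal_mult mult.assoc)
  have "averaged s r \<mu> w = (\<integral>\<^sup>+ z. ennreal ((1 + norm w) powr - s) * indicator (ball w r) z \<partial>\<mu>)"
    using cst[of 1] by simp
  also have "\<dots> \<le> (\<integral>\<^sup>+ z. ennreal c * (ennreal ((1 + norm z) powr - s) * indicator (ball w r) z) \<partial>\<mu>)"
    using inverses c
    by (intro nn_integral_mono) (auto simp: indicator_def dist_norm intro!: ennreal_leI simp flip: ennreal_mult)
  also have "\<dots> = ennreal c * emeasure (weighted_measure s \<mu>) (ball w r)"
    unfolding wt by (rule nn_integral_cmult) measurable
  finally show "averaged s r \<mu> w \<le> ennreal ((1 + r) powr s) * emeasure (weighted_measure s \<mu>) (ball w r)"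
    by (simp add: c_def)
  have "emeasure (weighted_measure s \<mu>) (ball w r)
      \<le> (\<integral>\<^sup>+ z. ennreal (c * (1 + norm w) powr - s) * indicator (ball w r) z \<partial>\<mu>)"
    unfolding wt using inverses c
    by (intro nn_integral_mono)
       (auto simp: indicator_def dist_norm norm_minus_commute intro!: ennreal_leI)
  then show "emeasure (weighted_measure s \<mu>) (ball w r) \<le> ennreal ((1 + r) powr s) * averaged s r \<mu> w"
    using cst[OF c] by (simp add: c_def)
qed

lemma averaged_measurable:
  fixes \<mu> :: "(complex ^ 'n::finite) measure"
  assumes "sets \<mu> = sets borel"
  shows "averaged s r \<mu> \<in> borel_measurable borel"
proof -
  have [measurable]: "(\<lambda>z. emeasure \<mu> (ball z r)) \<in> borel_measurable borel"
    using assms by (rule borel_measurable_emeasure_ball)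
  show ?thesis
    unfolding averaged_def[abs_def] by measurable
qed

lemma berezin_eq_gaussian_transform:
  assumes sets: "sets \<mu> = sets borel"
  shows "berezin \<alpha> t s \<mu> w
     = (\<integral>\<^sup>+ z. ennreal (exp (- (t * \<alpha> / 2) * (norm (z - w))\<^sup>2)) \<partial>weighted_measure s \<mu>)"
proof -
  have [measurable_cong]: "sets \<mu> = sets borel" by (rule sets)
  show ?thesis
    unfolding berezin_def weighted_measure_def
    by (subst nn_integral_density) (simp_all add: ennreal_mult)
qed

lemma berezin_measurable:
  fixes \<mu> :: "(complex ^ 'n::finite) measure"
  assumes sets: "sets \<mu> = sets borel" and fin: "emeasure (weighted_measure s \<mu>) UNIV < \<infinity>"
  shows "berezin \<alpha> t s \<mu> \<in> borel_measurable borel"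
proof -
  define \<nu> where "\<nu> = weighted_measure s \<mu>"
  have [measurable_cong]: "sets \<nu> = sets borel"
    using sets by (simp add: \<nu>_def)
  then have "space \<nu> = UNIV"
    using sets_eq_imp_space_eq[of \<nu> borel] by simp
  then interpret finite_measure \<nu>
    using fin by (intro finite_measureI) (simp add: \<nu>_def)
  have "(\<lambda>w. \<integral>\<^sup>+ z. ennreal (exp (- (t * \<alpha> / 2) * (norm (z - w))\<^sup>2)) \<partial>\<nu>) \<in> borel_measurable borel"
    by measurable
  then show ?thesis
    using berezin_eq_gaussian_transform[OF sets, of \<alpha> t s] by (simp add: \<nu>_def cong: measurable_cong)
qed

section \<open>Comparability with the total mass\<close>

lemma comparableI:
  fixes U V :: "(complex ^ 'n::finite) measure \<Rightarrow> ennreal"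
  assumes "C > 0" "\<And>\<mu>. sets \<mu> = sets borel \<Longrightarrow> U \<mu> \<le> ennreal C * V \<mu>"
    and "D > 0" "\<And>\<mu>. sets \<mu> = sets borel \<Longrightarrow> V \<mu> \<le> ennreal D * U \<mu>"
  shows "comparable U V"
  unfolding comparable_def
proof (intro exI[of _ "max C D"] conjI allI impI)
  fix \<mu> :: "(complex ^ 'n) measure" assume "sets \<mu> = sets borel"
  then have "U \<mu> \<le> ennreal C * V \<mu>" "V \<mu> \<le> ennreal D * U \<mu>"
    using assms by auto
  then show "U \<mu> \<le> ennreal (max C D) * V \<mu>" "V \<mu> \<le> ennreal (max C D) * U \<mu>"
    by (auto elim!: order.trans intro!: mult_right_mono ennreal_leI)
qed (use assms in auto)

lemma comparable_sym: "comparable U V \<Longrightarrow> comparable V U"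
  unfolding comparable_def by blast

lemma comparable_trans:
  assumes "comparable U V" "comparable V W" shows "comparable U W"
proof -
  obtain C where C: "C > 0"
    "\<And>\<mu>. sets \<mu> = sets borel \<Longrightarrow> U \<mu> \<le> ennreal C * V \<mu> \<and> V \<mu> \<le> ennreal C * U \<mu>"
    using assms(1) unfolding comparable_def by blast
  obtain D where D: "D > 0"
    "\<And>\<mu>. sets \<mu> = sets borel \<Longrightarrow> V \<mu> \<le> ennreal D * W \<mu> \<and> W \<mu> \<le> ennreal D * V \<mu>"
    using assms(2) unfolding comparable_def by blast
  show ?thesis
  proof (rule comparableI)
    fix \<mu> :: "(complex ^ 'a) measure" assume \<mu>: "sets \<mu> = sets borel"
    have "U \<mu> \<le> ennreal C * (ennreal D * W \<mu>)"
      using C(2)[OF \<mu>] D(2)[OF \<mu>] by (meson mult_left_mono order.trans zero_le)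
    then show "U \<mu> \<le> ennreal (C * D) * W \<mu>"
      using C(1) D(1) by (simp add: ennreal_mult mult.assoc)
    have "W \<mu> \<le> ennreal D * (ennreal C * U \<mu>)"
      using C(2)[OF \<mu>] D(2)[OF \<mu>] by (meson mult_left_mono order.trans zero_le)
    then show "W \<mu> \<le> ennreal (D * C) * U \<mu>"
      using C(1) D(1) by (simp add: ennreal_mult mult.assoc)
  qed (use C(1) D(1) in auto)
qed

lemma comparable_finite_iff:
  assumes "comparable U V" "sets \<mu> = sets borel"
  shows "U \<mu> < \<infinity> \<longleftrightarrow> V \<mu> < \<infinity>"
proof -
  obtain C where C: "C > 0" "U \<mu> \<le> ennreal C * V \<mu>" "V \<mu> \<le> ennreal C * U \<mu>"
    using assms unfolding comparable_def by blast
  have "ennreal C * x < \<infinity>" if "x < \<infinity>" for x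
    using that by (simp add: ennreal_mult_less_top)
  then show ?thesis
    using C(2,3) order.strict_trans1 by blast
qed

lemma berezin_comparable:
  assumes "\<alpha> > 0" "t > 0"
  shows "comparable (\<lambda>\<mu> :: (complex ^ 'n::finite) measure. L1_norm (berezin \<alpha> t s \<mu>))
    (\<lambda>\<mu>. emeasure (weighted_measure s \<mu>) UNIV)"
proof -
  define b where "b = t * \<alpha> / 2"
  have "b > 0" using assms by (simp add: b_def)
  obtain C where C: "C > 0" "\<And>\<nu> :: (complex ^ 'n) measure. sets \<nu> = sets borel \<Longrightarrow>
       (\<integral>\<^sup>+ w. \<integral>\<^sup>+ z. ennreal (exp (- b * (norm (z - w))\<^sup>2)) \<partial>\<nu> \<partial>lborel) \<le> ennreal C * emeasure \<nu> UNIV"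
    by (rule gaussian_transform_L1_le[OF \<open>b > 0\<close>]) blast
  obtain D where D: "D > 0" "\<And>\<nu> :: (complex ^ 'n) measure. sets \<nu> = sets borel \<Longrightarrow>
       emeasure \<nu> UNIV \<le> ennreal D * (\<integral>\<^sup>+ w. emeasure \<nu> (ball w 1) \<partial>lborel)"
    by (rule emeasure_le_ball_average_L1[OF zero_less_one]) blast
  have L1: "L1_norm (berezin \<alpha> t s \<mu>)
      = (\<integral>\<^sup>+ w. \<integral>\<^sup>+ z. ennreal (exp (- b * (norm (z - w))\<^sup>2)) \<partial>weighted_measure s \<mu> \<partial>lborel)"
    if "sets \<mu> = sets borel" for \<mu> :: "(complex ^ 'n) measure"
    by (simp add: L1_norm_def b_def berezin_eq_gaussian_transform[OF that])
  show ?thesis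
  proof (rule comparableI)
    fix \<mu> :: "(complex ^ 'n) measure" assume \<mu>: "sets \<mu> = sets borel"
    define \<nu> where "\<nu> = weighted_measure s \<mu>"
    have sets: "sets \<nu> = sets borel" using \<mu> by (simp add: \<nu>_def)
    show "L1_norm (berezin \<alpha> t s \<mu>) \<le> ennreal C * emeasure (weighted_measure s \<mu>) UNIV"
      unfolding L1[OF \<mu>] using \<mu> by (intro C(2)) simp
    have [measurable]: "(\<lambda>z. emeasure \<nu> (ball z 1)) \<in> borel_measurable borel"
      using sets by (rule borel_measurable_emeasure_ball)
    have "emeasure \<nu> UNIV \<le> ennreal D * (\<integral>\<^sup>+ w. emeasure \<nu> (ball w 1) \<partial>lborel)"
      by (rule D(2)[OF sets])
    also have "\<dots> = ennreal (D * exp b) * (\<integral>\<^sup>+ w. ennreal (exp (- (b * 1\<^sup>2))) * emeasure \<nu> (ball w 1) \<partial>lborel)"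
    proof -
      have "ennreal (D * exp b) * ennreal (exp (- b)) = ennreal D"
        using D(1) by (simp add: mult.assoc exp_minus_inverse flip: ennreal_mult)
      then show ?thesis
        by (simp add: nn_integral_cmult flip: mult.assoc)
    qed
    also have "\<dots> \<le> ennreal (D * exp b) * (\<integral>\<^sup>+ w. \<integral>\<^sup>+ z. ennreal (exp (- b * (norm (z - w))\<^sup>2)) \<partial>\<nu> \<partial>lborel)"
      using \<open>b > 0\<close> by (intro mult_left_mono nn_integral_mono emeasure_ball_le_gaussian_transform sets) auto
    finally show "emeasure (weighted_measure s \<mu>) UNIV \<le> ennreal (D * exp b) * L1_norm (berezin \<alpha> t s \<mu>)"
      unfolding L1[OF \<mu>] \<nu>_def .
  qed (use C(1) D(1) in auto)
qed

lemma averaged_comparable: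
  assumes "s \<ge> 0" "r > 0"
  shows "comparable (\<lambda>\<mu> :: (complex ^ 'n::finite) measure. L1_norm (averaged s r \<mu>))
    (\<lambda>\<mu>. emeasure (weighted_measure s \<mu>) UNIV)"
proof -
  obtain C where C: "C > 0" "\<And>\<nu> :: (complex ^ 'n) measure. sets \<nu> = sets borel \<Longrightarrow>
       (\<integral>\<^sup>+ w. emeasure \<nu> (ball w r) \<partial>lborel) \<le> ennreal C * emeasure \<nu> UNIV"
    by (rule ball_average_L1_le) blast
  obtain D where D: "D > 0" "\<And>\<nu> :: (complex ^ 'n) measure. sets \<nu> = sets borel \<Longrightarrow>
       emeasure \<nu> UNIV \<le> ennreal D * (\<integral>\<^sup>+ w. emeasure \<nu> (ball w r) \<partial>lborel)"
    by (rule emeasure_le_ball_average_L1[OF \<open>r > 0\<close>]) blast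
  define c where "c = (1 + r) powr s"
  have c: "c > 0" using \<open>r > 0\<close> by (simp add: c_def)
  show ?thesis
  proof (rule comparableI)
    fix \<mu> :: "(complex ^ 'n) measure" assume \<mu>: "sets \<mu> = sets borel"
    define \<nu> where "\<nu> = weighted_measure s \<mu>"
    have sets: "sets \<nu> = sets borel" using \<mu> by (simp add: \<nu>_def)
    have [measurable]: "(\<lambda>z. emeasure \<nu> (ball z r)) \<in> borel_measurable borel"
      using sets by (rule borel_measurable_emeasure_ball)
    have [measurable]: "averaged s r \<mu> \<in> borel_measurable borel"
      using \<mu> by (rule averaged_measurable)
    have "L1_norm (averaged s r \<mu>) \<le> (\<integral>\<^sup>+ w. ennreal c * emeasure \<nu> (ball w r) \<partial>lborel)"
      unfolding L1_norm_def c_def \<nu>_def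
      by (intro nn_integral_mono averaged_bounds(1) \<mu> assms)
    also have "\<dots> \<le> ennreal c * (ennreal C * emeasure \<nu> UNIV)"
      by (subst nn_integral_cmult) (auto intro!: mult_left_mono C(2) sets)
    finally show "L1_norm (averaged s r \<mu>) \<le> ennreal (c * C) * emeasure (weighted_measure s \<mu>) UNIV"
      using c C(1) by (simp add: \<nu>_def ennreal_mult mult.assoc)
    have "emeasure \<nu> UNIV \<le> ennreal D * (\<integral>\<^sup>+ w. emeasure \<nu> (ball w r) \<partial>lborel)"
      by (rule D(2)[OF sets])
    also have "\<dots> \<le> ennreal D * (\<integral>\<^sup>+ w. ennreal c * averaged s r \<mu> w \<partial>lborel)"
      unfolding c_def \<nu>_def
      by (intro mult_left_mono nn_integral_mono averaged_bounds(2) \<mu> assms) auto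
    also have "\<dots> = ennreal (D * c) * L1_norm (averaged s r \<mu>)"
      using c D(1) by (subst nn_integral_cmult) (auto simp: L1_norm_def ennreal_mult mult.assoc)
    finally show "emeasure (weighted_measure s \<mu>) UNIV \<le> ennreal (D * c) * L1_norm (averaged s r \<mu>)"
      by (simp add: \<nu>_def)
  qed (use c C(1) D(1) in auto)
qed

lemma lattice_sum_comparable:
  fixes z :: "nat \<Rightarrow> complex ^ 'n::finite"
  assumes lat: "half_lattice r z" and "s \<ge> 0"
  shows "comparable (\<lambda>\<mu>. (\<Sum>k. averaged s r \<mu> (z k))) (\<lambda>\<mu>. emeasure (weighted_measure s \<mu>) UNIV)"
proof -
  have r: "r > 0" using half_lattice_pos[OF lat] .
  obtain C where C: "C > 0" "\<And>\<nu>. sets \<nu> = sets borel \<Longrightarrow>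
       (\<Sum>k. emeasure \<nu> (ball (z k) r)) \<le> ennreal C * emeasure \<nu> UNIV"
    by (rule lattice_sum_le_emeasure[OF lat]) blast
  define c where "c = (1 + r) powr s"
  have c: "c > 0" using r by (simp add: c_def)
  show ?thesis
  proof (rule comparableI)
    fix \<mu> :: "(complex ^ 'n) measure" assume \<mu>: "sets \<mu> = sets borel"
    define \<nu> where "\<nu> = weighted_measure s \<mu>"
    have sets: "sets \<nu> = sets borel" using \<mu> by (simp add: \<nu>_def)
    have "(\<Sum>k. averaged s r \<mu> (z k)) \<le> (\<Sum>k. ennreal c * emeasure \<nu> (ball (z k) r))"
      unfolding c_def \<nu>_def by (intro suminf_le averaged_bounds(1) \<mu> r assms(2)) auto
    also have "\<dots> \<le> ennreal c * (ennreal C * emeasure \<nu> UNIV)"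
      unfolding ennreal_suminf_cmult by (intro mult_left_mono C(2) sets) auto
    finally show "(\<Sum>k. averaged s r \<mu> (z k)) \<le> ennreal (c * C) * emeasure (weighted_measure s \<mu>) UNIV"
      using c C(1) by (simp add: \<nu>_def ennreal_mult mult.assoc)
    have "emeasure \<nu> UNIV \<le> (\<Sum>k. emeasure \<nu> (ball (z k) r))"
      by (rule emeasure_le_lattice_sum[OF lat sets])
    also have "\<dots> \<le> (\<Sum>k. ennreal c * averaged s r \<mu> (z k))"
      unfolding c_def \<nu>_def by (intro suminf_le averaged_bounds(2) \<mu> r assms(2)) auto
    finally show "emeasure (weighted_measure s \<mu>) UNIV \<le> ennreal c * (\<Sum>k. averaged s r \<mu> (z k))"
      by (simp add: \<nu>_def)
  qed (use c C(1) in auto)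
qed

section \<open>The mass controls the embedding\<close>

lemma borel_measurable_entire_fun:
  assumes "entire_fun f" shows "f \<in> borel_measurable borel"
proof (rule borel_measurable_continuous_onI)
  show "continuous_on UNIV f"
    using assms unfolding entire_fun_def
    by (meson continuous_at_imp_continuous_on has_derivative_continuous)
qed

text \<open>
  The factor \<open>|z|\<^sup>m\<close> of the norm degenerates at the origin. Outside the unit ball \<open>1 + |z| \<le> 2 |z|\<close>; inside
  it, the maximum principle on the complex line through \<open>0\<close> and \<open>z\<close> bounds \<open>f\<close> by its values on the unit
  circle of that line, where \<open>|z|\<^sup>m = 1\<close>.
\<close>

lemma weighted_sup_le_fs_norm:
  fixes f :: "complex ^ 'n::finite \<Rightarrow> complex"
  assumes f: "entire_fun f" and "\<alpha> > 0"
    and fs: "fs_norm \<alpha> m f \<le> ennreal N" and "N \<ge> 0"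
  shows "(1 + norm z) ^ m * (cmod (f z) * exp (- (\<alpha> / 2) * (norm z)\<^sup>2)) \<le> 2 ^ m * exp (\<alpha> / 2) * N"
proof -
  have N: "norm z ^ m * cmod (f z) * exp (- (\<alpha> / 2) * (norm z)\<^sup>2) \<le> N" for z
  proof -
    have "ennreal (norm z ^ m * cmod (f z) * exp (- (\<alpha> / 2) * (norm z)\<^sup>2)) \<le> fs_norm \<alpha> m f"
      unfolding fs_norm_def by (rule SUP_upper) simp
    also note fs
    finally show ?thesis using \<open>N \<ge> 0\<close> by (simp add: ennreal_le_iff)
  qed
  show ?thesis
  proof (cases "norm z \<ge> 1")
    case True
    have "(1 + norm z) ^ m \<le> (2 * norm z) ^ m"
      using True by (intro power_mono) auto
    then have "(1 + norm z) ^ m * (cmod (f z) * exp (- (\<alpha> / 2) * (norm z)\<^sup>2))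
        \<le> (2 * norm z) ^ m * (cmod (f z) * exp (- (\<alpha> / 2) * (norm z)\<^sup>2))"
      by (rule mult_right_mono) auto
    also have "\<dots> = 2 ^ m * (norm z ^ m * cmod (f z) * exp (- (\<alpha> / 2) * (norm z)\<^sup>2))"
      by (simp add: power_mult_distrib)
    also have "\<dots> \<le> 2 ^ m * (exp (\<alpha> / 2) * N)"
      using N[of z] \<open>N \<ge> 0\<close> \<open>\<alpha> > 0\<close>
      by (intro mult_left_mono order.trans[OF N]) (auto simp: mult_le_cancel_right1)
    finally show ?thesis by (simp add: mult.assoc)
  next
    case False
    obtain u :: "complex ^ 'n" where u: "norm u = 1" "z = of_real (norm z) *s u"
    proof (cases "z = 0")
      case True
      then show thesis
        by (intro that[of "axis undefined 1"]) (auto simp: norm_axis_1)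
    next
      case False
      then show thesis
        by (intro that[of "(1 / norm z) *\<^sub>R z"])
           (simp_all add: vec_eq_iff scaleR_conv_of_real[where 'a = complex])
    qed
    \<comment> \<open>The restriction of \<open>f\<close> to the complex line spanned by \<open>u\<close>.\<close>
    define g where "g w = f (w *s u)" for w
    have norm_line: "norm (w *s u) = cmod w" for w
      using u(1) by (simp add: norm_vec_def norm_mult flip: L2_set_right_distrib)
    have "linear (\<lambda>w :: complex. w *s u)"
      by (rule linearI) (auto simp: vec_eq_iff algebra_simps)
    then have line: "((\<lambda>w. w *s u) has_derivative (\<lambda>w. w *s u)) (at w)" for w :: complex
      by (simp add: linear_conv_bounded_linear bounded_linear_imp_has_derivative)
    have hol: "g holomorphic_on UNIV"
      unfolding holomorphic_on_open[OF open_UNIV]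
    proof
      fix w
      obtain f' where f': "(f has_derivative f') (at (w *s u))" "\<And>c v. f' (c *s v) = c * f' v"
        using f unfolding entire_fun_def by blast
      have "(g has_derivative (\<lambda>h. f' (h *s u))) (at w)"
        unfolding g_def using has_derivative_compose[OF line f'(1)] .
      moreover have "(\<lambda>h. f' (h *s u)) = (*) (f' u)"
        by (auto simp: f'(2))
      ultimately show "\<exists>D. (g has_field_derivative D) (at w)"
        unfolding has_field_derivative_def by auto
    qed
    have circle: "cmod (g w) \<le> exp (\<alpha> / 2) * N" if "cmod w = 1" for w
    proof -
      have "cmod (g w) * exp (- (\<alpha> / 2)) \<le> N"
        using N[of "w *s u"] that by (simp add: norm_line g_def)
      then show ?thesis by (simp add: exp_minus field_simps)
    qed
    have "cmod (g (of_real (norm z))) \<le> exp (\<alpha> / 2) * N"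
    proof (rule maximum_modulus_frontier[of g "cball 0 1"])
      show "g holomorphic_on interior (cball 0 1)" "continuous_on (closure (cball 0 1)) g"
        using hol by (auto intro: holomorphic_on_subset holomorphic_on_imp_continuous_on)
      show "of_real (norm z) \<in> cball (0 :: complex) 1"
        using False by simp
    qed (use circle in auto)
    then have fz: "cmod (f z) \<le> exp (\<alpha> / 2) * N"
      using u(2) by (simp add: g_def)
    have "(1 + norm z) ^ m * (cmod (f z) * exp (- (\<alpha> / 2) * (norm z)\<^sup>2))
        \<le> 2 ^ m * (exp (\<alpha> / 2) * N * 1)"
      using False fz \<open>N \<ge> 0\<close> \<open>\<alpha> > 0\<close>
      by (intro mult_mono power_mono) auto
    then show ?thesis by (simp add: mult.assoc)
  qed
qed

lemma fc_integrand_le: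
  assumes "q > 0" "D \<ge> 0"
    and D: "(1 + norm z) ^ m * (x * exp (- (\<alpha> / 2) * (norm z)\<^sup>2)) \<le> D" and "x \<ge> 0"
  shows "x powr q * exp (- (\<alpha> * q / 2) * (norm z)\<^sup>2) \<le> D powr q * (1 + norm z) powr - (real m * q)"
proof -
  have pos: "1 + norm z > 0"
    using norm_ge_zero[of z] by linarith
  have "x powr q * exp (- (\<alpha> * q / 2) * (norm z)\<^sup>2) = (x * exp (- (\<alpha> / 2) * (norm z)\<^sup>2)) powr q"
    using \<open>x \<ge> 0\<close> by (simp add: powr_mult exp_powr_real mult_ac)
  also have "\<dots> \<le> (D / (1 + norm z) ^ m) powr q"
    using assms pos by (intro powr_mono2) (auto simp: field_simps)
  also have "\<dots> = D powr q * (1 + norm z) powr - (real m * q)"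
    using pos \<open>D \<ge> 0\<close> by (simp add: powr_divide powr_minus powr_powr field_simps flip: powr_realpow)
  finally show ?thesis .
qed

lemma fc_integral_le_weighted_mass:
  fixes f :: "complex ^ 'n::finite \<Rightarrow> complex"
  assumes sets: "sets \<mu> = sets borel" and "q > 0" "D \<ge> 0"
    and D: "\<And>z. (1 + norm z) ^ m * (cmod (f z) * exp (- (\<alpha> / 2) * (norm z)\<^sup>2)) \<le> D"
  shows "fc_integral \<alpha> q \<mu> f \<le> ennreal (D powr q) * emeasure (weighted_measure (real m * q) \<mu>) UNIV"
proof -
  have [measurable_cong]: "sets \<mu> = sets borel" by (rule sets)
  have "fc_integral \<alpha> q \<mu> f \<le> (\<integral>\<^sup>+ z. ennreal (D powr q) * ennreal ((1 + norm z) powr - (real m * q)) \<partial>\<mu>)"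
    unfolding fc_integral_def
    using fc_integrand_le[OF \<open>q > 0\<close> \<open>D \<ge> 0\<close> D]
    by (intro nn_integral_mono) (simp add: ennreal_leI flip: ennreal_mult)
  also have "\<dots> = ennreal (D powr q) * (\<integral>\<^sup>+ z. ennreal ((1 + norm z) powr - (real m * q)) \<partial>\<mu>)"
    by (rule nn_integral_cmult) measurable
  also have "(\<integral>\<^sup>+ z. ennreal ((1 + norm z) powr - (real m * q)) \<partial>\<mu>)
      = emeasure (weighted_measure (real m * q) \<mu>) UNIV"
    by (rule emeasure_weighted_measure_UNIV[OF sets, symmetric])
  finally show ?thesis .
qed

text \<open>
  On the extended half-line \<open>0 * \<infinity> = 0\<close>, so for a function of infinite norm the inequality still has
  content when the mass vanishes; then \<open>\<mu>\<close> itself is the zero measure, as the weight is positive.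
\<close>

lemma fc_integral_le_fs_norm:
  fixes f :: "complex ^ 'n::finite \<Rightarrow> complex"
  assumes sets: "sets \<mu> = sets borel" and "\<alpha> > 0" "q > 0" and f: "entire_fun f"
  shows "fc_integral \<alpha> q \<mu> f \<le> ennreal ((2 ^ m * exp (\<alpha> / 2)) powr q)
     * emeasure (weighted_measure (real m * q) \<mu>) UNIV * ennpowr (fs_norm \<alpha> m f) q"
proof (cases "fs_norm \<alpha> m f = \<infinity>")
  case False
  define N where "N = enn2real (fs_norm \<alpha> m f)"
  have N: "fs_norm \<alpha> m f = ennreal N" "N \<ge> 0"
    using False by (auto simp: N_def less_top)
  have "fc_integral \<alpha> q \<mu> f \<le> ennreal ((2 ^ m * exp (\<alpha> / 2) * N) powr q)
      * emeasure (weighted_measure (real m * q) \<mu>) UNIV"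
    using weighted_sup_le_fs_norm[OF f \<open>\<alpha> > 0\<close>, of m N] N
    by (intro fc_integral_le_weighted_mass sets \<open>q > 0\<close>) auto
  also have "ennreal ((2 ^ m * exp (\<alpha> / 2) * N) powr q)
      = ennreal ((2 ^ m * exp (\<alpha> / 2)) powr q) * ennpowr (fs_norm \<alpha> m f) q"
    using N by (simp add: ennpowr_def powr_mult ennreal_mult)
  finally show ?thesis by (simp add: mult_ac)
next
  case True
  show ?thesis
  proof (cases "emeasure (weighted_measure (real m * q) \<mu>) UNIV = 0")
    case True
    have [measurable_cong]: "sets \<mu> = sets borel" by (rule sets)
    have "emeasure (weighted_measure (real m * q) \<mu>) UNIV
        = (\<integral>\<^sup>+ z. ennreal ((1 + norm z) powr - (real m * q)) \<partial>\<mu>)"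
      by (rule emeasure_weighted_measure_UNIV[OF sets])
    with True have "(\<integral>\<^sup>+ z. ennreal ((1 + norm z) powr - (real m * q)) \<partial>\<mu>) = 0"
      by simp
    then have "AE z in \<mu>. ennreal ((1 + norm z) powr - (real m * q)) = 0"
      by (subst (asm) nn_integral_0_iff_AE) auto
    then have "AE z in \<mu>. False"
    proof eventually_elim
      case (elim z)
      moreover have "(1 + norm z) powr - (real m * q) > 0"
        using norm_ge_zero[of z] by (simp add: add_nonneg_eq_0_iff)
      ultimately show ?case by simp
    qed
    then have "fc_integral \<alpha> q \<mu> f = (\<integral>\<^sup>+ z. 0 \<partial>\<mu>)"
      unfolding fc_integral_def by (intro nn_integral_cong_AE) auto
    then show ?thesis by simp
  next
    case False
    then show ?thesis
      using \<open>fs_norm \<alpha> m f = \<infinity>\<close> by (simp add: ennpowr_def ennreal_mult_top)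
  qed
qed

text \<open>
  The integrands are dominated by a multiple of \<open>(1 + |z|)\<^sup>-\<^sup>m\<^sup>q\<close>, which is integrable by assumption, and
  they tend to zero pointwise.
\<close>

lemma vanishing_if_finite_mass:
  fixes \<mu> :: "(complex ^ 'n::finite) measure"
  assumes "\<alpha> > 0" "q > 0" and \<mu>: "sets \<mu> = sets borel"
    and fin: "emeasure (weighted_measure (real m * q) \<mu>) UNIV < \<infinity>"
  shows "vanishing_fock_carleson \<alpha> m q \<mu>"
  unfolding vanishing_fock_carleson_def
proof (intro allI impI)
  fix f :: "nat \<Rightarrow> complex ^ 'n \<Rightarrow> complex"
  assume f: "\<forall>j. f j \<in> fock_sobolev \<alpha> m" and bd: "(SUP j. fs_norm \<alpha> m (f j)) < \<infinity>"
    and lim: "\<forall>K. compact K \<longrightarrow> uniform_limit K f (\<lambda>_. 0) sequentially"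
  have [measurable_cong]: "sets \<mu> = sets borel" by (rule \<mu>)
  have entire: "entire_fun (f j)" for j
    using f by (simp add: fock_sobolev_def)
  then have [measurable]: "f j \<in> borel_measurable borel" for j
    by (rule borel_measurable_entire_fun)
  define N where "N = enn2real (SUP j. fs_norm \<alpha> m (f j))"
  have N: "(SUP j. fs_norm \<alpha> m (f j)) = ennreal N" "N \<ge> 0"
    using bd by (auto simp: N_def)
  have fs: "fs_norm \<alpha> m (f j) \<le> ennreal N" for j
    unfolding N(1)[symmetric] by (rule SUP_upper) simp
  define D where "D = 2 ^ m * exp (\<alpha> / 2) * N"
  have D: "D \<ge> 0" using N(2) by (simp add: D_def)
  define u where "u j z = ennreal (cmod (f j z) powr q * exp (- (\<alpha> * q / 2) * (norm z)\<^sup>2))" for j z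
  define w where "w z = ennreal (D powr q * (1 + norm z) powr - (real m * q))" for z :: "complex ^ 'n"
  have "(\<lambda>j. \<integral>\<^sup>+ z. u j z \<partial>\<mu>) \<longlonglongrightarrow> (\<integral>\<^sup>+ z. 0 \<partial>\<mu>)"
  proof (rule nn_integral_dominated_convergence)
    show "u j \<in> borel_measurable \<mu>" for j
      unfolding u_def by measurable
    show "w \<in> borel_measurable \<mu>"
      unfolding w_def by measurable
    show "AE z in \<mu>. u j z \<le> w z" for j
      unfolding u_def w_def
      using weighted_sup_le_fs_norm[OF entire \<open>\<alpha> > 0\<close> fs N(2)]
      by (intro AE_I2 ennreal_leI fc_integrand_le \<open>q > 0\<close> D) (auto simp: D_def)
    have "integral\<^sup>N \<mu> w = ennreal (D powr q) * (\<integral>\<^sup>+ z. ennreal ((1 + norm z) powr - (real m * q)) \<partial>\<mu>)"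
      unfolding w_def by (simp add: ennreal_mult nn_integral_cmult)
    also have "(\<integral>\<^sup>+ z. ennreal ((1 + norm z) powr - (real m * q)) \<partial>\<mu>)
        = emeasure (weighted_measure (real m * q) \<mu>) UNIV"
      by (rule emeasure_weighted_measure_UNIV[OF \<mu>, symmetric])
    finally show "integral\<^sup>N \<mu> w < \<infinity>"
      using fin by (simp add: ennreal_mult_less_top)
    show "AE z in \<mu>. (\<lambda>j. u j z) \<longlonglongrightarrow> 0"
    proof (rule AE_I2)
      fix z
      have "uniform_limit {z} f (\<lambda>_. 0) sequentially"
        by (rule lim[rule_format]) simp
      then have "(\<lambda>j. f j z) \<longlonglongrightarrow> 0"
        by (rule tendsto_uniform_limitI) simp
      then have "(\<lambda>j. cmod (f j z) powr q) \<longlonglongrightarrow> 0"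
        using \<open>q > 0\<close> by (intro tendsto_zero_powrI[OF tendsto_norm_zero tendsto_const]) auto
      then have "(\<lambda>j. cmod (f j z) powr q * exp (- (\<alpha> * q / 2) * (norm z)\<^sup>2)) \<longlonglongrightarrow> 0"
        by (rule tendsto_mult_left_zero)
      then show "(\<lambda>j. u j z) \<longlonglongrightarrow> 0"
        unfolding u_def by (subst ennreal_0[symmetric], intro tendsto_ennrealI)
    qed
  qed simp
  then show "(\<lambda>j. fc_integral \<alpha> q \<mu> (f j)) \<longlonglongrightarrow> 0"
    by (simp add: fc_integral_def u_def)
qed

section \<open>Test functions\<close>

definition hermitian :: "complex ^ 'n::finite \<Rightarrow> complex ^ 'n \<Rightarrow> complex" where
  "hermitian z w = (\<Sum>i\<in>UNIV. z $ i * cnj (w $ i))"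

lemma Re_hermitian: "Re (hermitian z w) = z \<bullet> w"
  by (simp add: hermitian_def inner_vec_def inner_complex_def)

text \<open>
  These functions form a space that is stable under all partial derivatives and whose elements grow at
  most like \<open>exp (const * |z|)\<close>, which makes their membership in the Fock--Sobolev spaces easy to verify.
\<close>

definition exp_sum ::
    "'k set \<Rightarrow> ('k \<Rightarrow> complex ^ 'n::finite) \<Rightarrow> ('k \<Rightarrow> complex) \<Rightarrow> complex ^ 'n \<Rightarrow> complex" where
  "exp_sum K a c z = (\<Sum>k\<in>K. c k * exp (hermitian z (a k)))"

lemma exp_sum_cmult: "exp_sum K a (\<lambda>k. b * c k) z = b * exp_sum K a c z"
  by (simp add: exp_sum_def sum_distrib_left mult.assoc)

lemma cpartial_exp_sum:
  "cpartial i (exp_sum K a c) = exp_sum K a (\<lambda>k. c k * cnj (a k $ i))"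
proof
  fix z
  have shift: "hermitian (z + w *s axis i 1) (a k) = hermitian z (a k) + w * cnj (a k $ i)" for w k
  proof -
    have "(\<Sum>j\<in>UNIV. (w *s axis i 1) $ j * cnj (a k $ j))
        = (\<Sum>j\<in>UNIV. if j = i then w * cnj (a k $ i) else 0)"
      by (intro sum.cong) (auto simp: axis_def)
    then show ?thesis
      by (simp add: hermitian_def distrib_right sum.distrib)
  qed
  have "((\<lambda>w. exp_sum K a c (z + w *s axis i 1)) has_field_derivative
      exp_sum K a (\<lambda>k. c k * cnj (a k $ i)) z) (at 0)"
    unfolding exp_sum_def shift by (rule derivative_eq_intros refl | simp add: mult_ac)+
  then show "cpartial i (exp_sum K a c) z = exp_sum K a (\<lambda>k. c k * cnj (a k $ i)) z"
    unfolding cpartial_def by (rule DERIV_imp_deriv)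
qed

lemma multi_deriv_exp_sum: "\<exists>c'. multi_deriv \<beta> (exp_sum K a c) = exp_sum K a c'"
proof -
  have iter: "\<exists>c'. (cpartial i ^^ j) (exp_sum K a c) = exp_sum K a c'" for i j c
    by (induction j) (auto simp: cpartial_exp_sum)
  have "\<exists>c'. foldr (\<lambda>i. cpartial i ^^ \<beta> i) is (exp_sum K a c) = exp_sum K a c'" for "is"
  proof (induction "is")
    case Nil
    then show ?case by auto
  next
    case (Cons i "is")
    then obtain c' where "foldr (\<lambda>i. cpartial i ^^ \<beta> i) is (exp_sum K a c) = exp_sum K a c'" by blast
    then show ?case using iter[of "\<beta> i" i c'] by simp
  qed
  then show ?thesis unfolding multi_deriv_def .
qed

lemma entire_fun_exp_sum:
  fixes a :: "'k \<Rightarrow> complex ^ 'n::finite"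
  shows "entire_fun (exp_sum K a c)"
  unfolding entire_fun_def
proof
  fix z :: "complex ^ 'n"
  have lin: "bounded_linear (\<lambda>v :: complex ^ 'n. hermitian v w)" for w
    unfolding hermitian_def
    by (intro bounded_linear_sum bounded_linear_mult_const bounded_linear_vec_nth)
  have hom: "hermitian (b *s v) w = b * hermitian v w" for b v and w :: "complex ^ 'n"
    by (simp add: hermitian_def sum_distrib_left mult.assoc)
  define f' where "f' v = (\<Sum>k\<in>K. c k * (exp (hermitian z (a k)) * hermitian v (a k)))" for v
  have "(exp_sum K a c has_derivative f') (at z)"
    unfolding exp_sum_def[abs_def] f'_def[abs_def]
    by (intro has_derivative_sum has_derivative_mult_right
        has_derivative_compose[OF bounded_linear_imp_has_derivative[OF lin]]
        has_field_derivative_imp_has_derivative DERIV_exp)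
  moreover have "f' (b *s v) = b * f' v" for b v
    by (simp add: f'_def hom sum_distrib_left mult_ac)
  ultimately show "\<exists>f'. (exp_sum K a c has_derivative f') (at z) \<and> (\<forall>c v. f' (c *s v) = c * f' v)"
    by blast
qed

lemma exp_sum_in_fock_sobolev:
  assumes "\<alpha> > 0"
  shows "exp_sum K a c \<in> fock_sobolev \<alpha> m"
proof -
  have bd: "cmod (exp_sum K a c z) * exp (- (\<alpha> / 2) * (norm z)\<^sup>2)
      \<le> (\<Sum>k\<in>K. cmod (c k) * exp ((norm (a k))\<^sup>2 / (2 * \<alpha>)))" for c z
  proof -
    have each: "exp (z \<bullet> a k) * exp (- (\<alpha> / 2) * (norm z)\<^sup>2) \<le> exp ((norm (a k))\<^sup>2 / (2 * \<alpha>))" for k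
    proof -
      \<comment> \<open>Completing the square.\<close>
      have "0 \<le> (norm (\<alpha> *\<^sub>R z - a k))\<^sup>2 / (2 * \<alpha>)"
        using assms by simp
      also have "(norm (\<alpha> *\<^sub>R z - a k))\<^sup>2 = \<alpha>\<^sup>2 * (norm z)\<^sup>2 - 2 * \<alpha> * (z \<bullet> a k) + (norm (a k))\<^sup>2"
        unfolding power2_norm_eq_inner by (simp add: inner_diff inner_commute power2_eq_square)
      also have "\<dots> / (2 * \<alpha>) = (\<alpha> / 2) * (norm z)\<^sup>2 - z \<bullet> a k + (norm (a k))\<^sup>2 / (2 * \<alpha>)"
        using assms by (simp add: field_simps power2_eq_square)
      finally show ?thesis by (simp flip: exp_add)
    qed
    have "cmod (exp_sum K a c z) * exp (- (\<alpha> / 2) * (norm z)\<^sup>2)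
        \<le> (\<Sum>k\<in>K. cmod (c k) * exp (z \<bullet> a k)) * exp (- (\<alpha> / 2) * (norm z)\<^sup>2)"
      unfolding exp_sum_def
      by (intro mult_right_mono order.trans[OF norm_sum]) (auto simp: norm_mult Re_hermitian)
    also have "\<dots> \<le> (\<Sum>k\<in>K. cmod (c k) * exp ((norm (a k))\<^sup>2 / (2 * \<alpha>)))"
      unfolding sum_distrib_right mult.assoc by (intro sum_mono mult_left_mono each) auto
    finally show ?thesis .
  qed
  have "(SUP z. ennreal (cmod (multi_deriv \<beta> (exp_sum K a c) z) * exp (- (\<alpha> / 2) * (norm z)\<^sup>2))) < \<infinity>"
    for \<beta>
  proof -
    obtain c' where c': "multi_deriv \<beta> (exp_sum K a c) = exp_sum K a c'"
      using multi_deriv_exp_sum by blast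
    have "(SUP z. ennreal (cmod (exp_sum K a c' z) * exp (- (\<alpha> / 2) * (norm z)\<^sup>2)))
        \<le> ennreal (\<Sum>k\<in>K. cmod (c' k) * exp ((norm (a k))\<^sup>2 / (2 * \<alpha>)))"
      by (intro SUP_least ennreal_leI bd)
    then show ?thesis unfolding c' by (rule order.strict_trans1) simp
  qed
  then show ?thesis
    by (simp add: fock_sobolev_def entire_fun_exp_sum finite_multi_indices)
qed

text \<open>
  Pair each choice of signs with the one that differs from it in position \<open>j\<close> only. If the other terms
  add up to \<open>X\<close>, then \<open>2 |c\<^sub>j| \<le> |X + c\<^sub>j| + |X - c\<^sub>j|\<close>, so one of the two moduli is at least \<open>|c\<^sub>j|\<close>. The sets
  \<open>S\<close> are the sets of positions with a plus sign.
\<close>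

lemma sum_signs_powr_ge:
  fixes c :: "'k \<Rightarrow> complex"
  assumes "finite K" "j \<in> K" "q > 0"
  shows "2 ^ card K / 2 * cmod (c j) powr q
     \<le> (\<Sum>S\<in>Pow K. cmod (\<Sum>k\<in>K. (if k \<in> S then 1 else - 1) * c k) powr q)"
proof -
  define L where "L = K - {j}"
  have L: "K = insert j L" "j \<notin> L" "finite L"
    using assms by (auto simp: L_def)
  define F where "F S = cmod (\<Sum>k\<in>K. (if k \<in> S then 1 else - 1) * c k) powr q" for S
  have pair: "cmod (c j) powr q \<le> F S + F (insert j S)" if "S \<in> Pow L" for S
  proof -
    define X where "X = (\<Sum>k\<in>L. (if k \<in> S then 1 else - 1) * c k)"
    have "(\<Sum>k\<in>L. (if k \<in> insert j S then 1 else - 1) * c k) = X"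
      unfolding X_def using L(2) by (intro sum.cong) auto
    then have F: "F (insert j S) = cmod (X + c j) powr q" "F S = cmod (X - c j) powr q"
      using L that by (auto simp: F_def X_def add.commute)
    have "2 * cmod (c j) = cmod ((X + c j) - (X - c j))"
      by (simp flip: mult_2 add: norm_mult)
    also have "\<dots> \<le> cmod (X + c j) + cmod (X - c j)"
      by (rule norm_triangle_ineq4)
    finally consider "cmod (c j) \<le> cmod (X + c j)" | "cmod (c j) \<le> cmod (X - c j)"
      by linarith
    then show ?thesis
    proof cases
      case 1
      then have "cmod (c j) powr q \<le> cmod (X + c j) powr q"
        using \<open>q > 0\<close> by (intro powr_mono2) auto
      then show ?thesis by (simp add: F add_increasing)
    next
      case 2
      then have "cmod (c j) powr q \<le> cmod (X - c j) powr q"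
        using \<open>q > 0\<close> by (intro powr_mono2) auto
      then show ?thesis by (simp add: F add_increasing2)
    qed
  qed
  have inj: "inj_on (insert j) (Pow L)"
    using L(2) by (auto simp: inj_on_def)
  have "2 ^ card K / 2 * cmod (c j) powr q = (\<Sum>S\<in>Pow L. cmod (c j) powr q)"
    using L by (simp add: card_Pow)
  also have "\<dots> \<le> (\<Sum>S\<in>Pow L. F S + F (insert j S))"
    by (intro sum_mono pair)
  also have "\<dots> = (\<Sum>S\<in>Pow L. F S) + (\<Sum>S\<in>insert j ` Pow L. F S)"
    by (simp add: sum.distrib sum.reindex[OF inj])
  also have "\<dots> = (\<Sum>S\<in>Pow K. F S)"
    unfolding L(1) Pow_insert using L by (subst sum.union_disjoint) auto
  finally show ?thesis by (simp add: F_def)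
qed

text \<open>
  The test functions are normalised kernels at the points of a lattice, added up with arbitrary signs.
  Up to the weight, the kernel at \<open>p\<^sub>k\<close> has modulus \<open>exp (- \<alpha> |z - p\<^sub>k|\<^sup>2 / 2)\<close> after multiplication by
  \<open>exp (- \<alpha> |z|\<^sup>2 / 2)\<close>; hence the uniform bound \<open>A\<close>, by summation over the lattice. For the bound on
  the mass, the sum over all signs of the integrals is at most their number times \<open>T\<close>, while the sum
  of the integrands is, on the ball about each \<open>p\<^sub>k\<close>, at least a constant times their number times the
  weight. Scalar multiples of test functions occur in the membership statement because the vanishing
  property has to be tested on a sequence that tends to zero.
\<close>

lemma lattice_test_functions:
  fixes \<alpha> q :: real and m :: nat
  assumes "\<alpha> > 0" "q > 0"
  obtains F :: "(complex ^ 'n::finite \<Rightarrow> complex) set" and A B :: real where "A > 0" "B > 0"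
    "\<And>f c. f \<in> F \<Longrightarrow> (\<lambda>z. c * f z) \<in> fock_sobolev \<alpha> m"
    "\<And>f z. f \<in> F \<Longrightarrow> (1 + norm z) ^ m * (cmod (f z) * exp (- (\<alpha> / 2) * (norm z)\<^sup>2)) \<le> A"
    "\<And>\<mu> T. sets \<mu> = sets borel \<Longrightarrow> (\<And>f. f \<in> F \<Longrightarrow> fc_integral \<alpha> q \<mu> f \<le> T) \<Longrightarrow>
       emeasure (weighted_measure (real m * q) \<mu>) UNIV \<le> ennreal B * T"
proof -
  obtain p :: "nat \<Rightarrow> complex ^ 'n" where lat: "half_lattice 1 p"
    by (rule half_lattice_exists[OF zero_less_one])
  have "\<alpha> / 4 > 0" using \<open>\<alpha> > 0\<close> by simp
  then obtain G where G: "G > 0" "\<And>w. (\<Sum>k. ennreal (exp (- (\<alpha> / 4) * (norm (w - p k))\<^sup>2))) \<le> ennreal G"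
    by (rule gaussian_lattice_sum_bounded[OF lat]) blast
  define d where "d k = exp (- (\<alpha> / 2) * (norm (p k))\<^sup>2) / (1 + norm (p k)) ^ m" for k
  define c where "c S k = (if k \<in> S then 1 else - 1) * complex_of_real (d k)" for S k
  define test where "test N S = exp_sum {..<N} (\<lambda>k. \<alpha> *\<^sub>R p k) (c S)" for N :: nat and S :: "nat set"
  define F where "F = {test N S |N S. True}"
  have d_pos: "d k > 0" for k
    using norm_ge_zero[of "p k"] by (auto simp: d_def intro!: divide_pos_pos zero_less_power add_pos_nonneg)
  have norm_c: "cmod (c S k) = d k" for S k
    using d_pos[of k] by (simp add: c_def norm_mult)
  have kernel: "d k * exp (z \<bullet> (\<alpha> *\<^sub>R p k)) * exp (- (\<alpha> / 2) * (norm z)\<^sup>2)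
      = exp (- (\<alpha> / 2) * (norm (z - p k))\<^sup>2) / (1 + norm (p k)) ^ m" for k z
  proof -
    have sq: "(norm (z - p k))\<^sup>2 = (norm z)\<^sup>2 - 2 * (z \<bullet> p k) + (norm (p k))\<^sup>2"
      by (simp add: power2_norm_eq_inner inner_diff inner_commute)
    have "exp (- (\<alpha> / 2) * (norm (p k))\<^sup>2) * exp (z \<bullet> (\<alpha> *\<^sub>R p k)) * exp (- (\<alpha> / 2) * (norm z)\<^sup>2)
        = exp (- (\<alpha> / 2) * (norm (z - p k))\<^sup>2)"
      unfolding exp_add[symmetric] sq by (simp add: algebra_simps)
    then show ?thesis
      by (simp add: d_def)
  qed
  have weight: "(1 + norm x) ^ m \<le> (1 + norm (x - y)) ^ m * (1 + norm y) ^ m" for x y :: "complex ^ 'n"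
  proof -
    have "1 + norm x \<le> (1 + norm (x - y)) * (1 + norm y)"
      by (rule one_plus_norm_le)
    then show ?thesis
      unfolding power_mult_distrib[symmetric] by (intro power_mono) auto
  qed
  define A where "A = fact m * exp (1 + 1 / \<alpha>) * G"
  have bound: "(1 + norm z) ^ m * (cmod (test N S z) * exp (- (\<alpha> / 2) * (norm z)\<^sup>2)) \<le> A" for N S z
  proof -
    have term_le: "(1 + norm z) ^ m * (d k * exp (z \<bullet> (\<alpha> *\<^sub>R p k)) * exp (- (\<alpha> / 2) * (norm z)\<^sup>2))
        \<le> fact m * exp (1 + 1 / \<alpha>) * exp (- (\<alpha> / 4) * (norm (z - p k))\<^sup>2)" for k
    proof -
      have pos: "(1 + norm (p k)) ^ m > 0"
        using norm_ge_zero[of "p k"] by (intro zero_less_power) linarith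
      have "(1 + norm z) ^ m / (1 + norm (p k)) ^ m * exp (- (\<alpha> / 2) * (norm (z - p k))\<^sup>2)
          \<le> (1 + norm (z - p k)) ^ m * exp (- (\<alpha> / 2) * (norm (z - p k))\<^sup>2)"
        using weight[of z "p k"] pos by (intro mult_right_mono) (auto simp: divide_le_eq)
      also have "\<dots> \<le> fact m * exp (1 + 1 / \<alpha>) * exp (- (\<alpha> / 4) * (norm (z - p k))\<^sup>2)"
        using power_times_gaussian_le[of "\<alpha> / 2" "norm (z - p k)" m] \<open>\<alpha> > 0\<close> by simp
      finally show ?thesis unfolding kernel by simp
    qed
    have "cmod (test N S z) \<le> (\<Sum>k<N. d k * exp (z \<bullet> (\<alpha> *\<^sub>R p k)))"
      unfolding test_def exp_sum_def
      by (rule order.trans[OF norm_sum]) (simp add: norm_mult norm_c Re_hermitian)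
    then have "(1 + norm z) ^ m * (cmod (test N S z) * exp (- (\<alpha> / 2) * (norm z)\<^sup>2))
        \<le> (1 + norm z) ^ m * ((\<Sum>k<N. d k * exp (z \<bullet> (\<alpha> *\<^sub>R p k))) * exp (- (\<alpha> / 2) * (norm z)\<^sup>2))"
      by (intro mult_left_mono mult_right_mono) auto
    also have "\<dots> = (\<Sum>k<N. (1 + norm z) ^ m * (d k * exp (z \<bullet> (\<alpha> *\<^sub>R p k)) * exp (- (\<alpha> / 2) * (norm z)\<^sup>2)))"
      by (simp only: sum_distrib_left sum_distrib_right)
    also have "\<dots> \<le> (\<Sum>k<N. fact m * exp (1 + 1 / \<alpha>) * exp (- (\<alpha> / 4) * (norm (z - p k))\<^sup>2))"
      by (intro sum_mono term_le)
    also have "\<dots> = fact m * exp (1 + 1 / \<alpha>) * (\<Sum>k<N. exp (- (\<alpha> / 4) * (norm (z - p k))\<^sup>2))"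
      by (simp only: sum_distrib_left)
    also have "\<dots> \<le> A"
    proof -
      have "ennreal (\<Sum>k<N. exp (- (\<alpha> / 4) * (norm (z - p k))\<^sup>2))
          = (\<Sum>k<N. ennreal (exp (- (\<alpha> / 4) * (norm (z - p k))\<^sup>2)))"
        by (subst sum_ennreal) auto
      also have "\<dots> \<le> ennreal G"
        by (rule order.trans[OF sum_le_suminf G(2)]) auto
      finally have "(\<Sum>k<N. exp (- (\<alpha> / 4) * (norm (z - p k))\<^sup>2)) \<le> G"
        using G(1) by (simp add: ennreal_le_iff)
      then show ?thesis
        unfolding A_def by (intro mult_left_mono) auto
    qed
    finally show ?thesis .
  qed
  \<comment> \<open>At distance less than \<open>1\<close> from \<open>p\<^sub>k\<close> the Gaussian is at least \<open>exp (- \<alpha> / 2)\<close>, and the weights at \<open>z\<close> and at \<open>p\<^sub>k\<close> differ by a factor of at most \<open>2\<^sup>m\<close>.\<close>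
  define \<kappa> where "\<kappa> = (exp (- (\<alpha> / 2)) / 2 ^ m) powr q"
  have \<kappa>: "\<kappa> > 0" by (simp add: \<kappa>_def)
  have mass: "emeasure (weighted_measure (real m * q) \<mu>) UNIV \<le> ennreal (2 / \<kappa>) * T"
    if sets: "sets \<mu> = sets borel" and T: "\<And>f. f \<in> F \<Longrightarrow> fc_integral \<alpha> q \<mu> f \<le> T"
    for \<mu> :: "(complex ^ 'n) measure" and T
  proof -
    have [measurable_cong]: "sets \<mu> = sets borel" by (rule sets)
    define w where "w z = (1 + norm z) powr - (real m * q)" for z :: "complex ^ 'n"
    define U where "U N = (\<Union>k<N. ball (p k) 1)" for N
    define I where "I N S z = cmod (test N S z) powr q * exp (- (\<alpha> * q / 2) * (norm z)\<^sup>2)" for N S z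
    have [measurable]: "test N S \<in> borel_measurable borel" for N S
      unfolding test_def by (intro borel_measurable_entire_fun entire_fun_exp_sum)
    have [measurable]: "I N S \<in> borel_measurable borel" for N S
      unfolding I_def[abs_def] by measurable
    have U_borel: "U N \<in> sets borel" for N
      unfolding U_def by (intro borel_open open_UN) auto
    have average: "2 ^ N / 2 * \<kappa> * w z \<le> (\<Sum>S\<in>Pow {..<N}. I N S z)" if "z \<in> U N" for N z
    proof -
      from that obtain k where k: "k < N" "norm (z - p k) < 1"
        by (auto simp: U_def dist_norm norm_minus_commute)
      \<comment> \<open>The kernels without their signs, multiplied by \<open>exp (- \<alpha> |z|\<^sup>2 / 2)\<close>.\<close>
      define e where "e k = exp (hermitian z (\<alpha> *\<^sub>R p k)) * of_real (d k * exp (- (\<alpha> / 2) * (norm z)\<^sup>2))" for k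
      have pos: "1 + norm z > 0" "1 + norm (p k) > 0"
        using norm_ge_zero[of z] norm_ge_zero[of "p k"] by linarith+
      have "1 + norm (p k) \<le> 2 + 2 * norm z"
        using k(2) norm_triangle_ineq2[of "p k" z] norm_ge_zero[of z]
        unfolding norm_minus_commute[of "p k"] by linarith
      then have "(1 + norm (p k)) ^ m \<le> (2 * (1 + norm z)) ^ m"
        by (intro power_mono) auto
      moreover have "exp (- (\<alpha> / 2)) \<le> exp (- (\<alpha> / 2) * (norm (z - p k))\<^sup>2)"
        using k(2) \<open>\<alpha> > 0\<close> by (simp add: mult_le_cancel_left1 power_le_one)
      ultimately have "exp (- (\<alpha> / 2)) / (2 * (1 + norm z)) ^ m
          \<le> exp (- (\<alpha> / 2) * (norm (z - p k))\<^sup>2) / (1 + norm (p k)) ^ m"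
        using pos by (intro frac_le) auto
      also have "\<dots> = cmod (e k)"
        unfolding kernel[symmetric] using d_pos[of k] by (simp add: e_def norm_mult Re_hermitian)
      finally have "(exp (- (\<alpha> / 2)) / (2 * (1 + norm z)) ^ m) powr q \<le> cmod (e k) powr q"
        using pos \<open>q > 0\<close> by (intro powr_mono2) auto
      moreover have "(exp (- (\<alpha> / 2)) / (2 * (1 + norm z)) ^ m) powr q = \<kappa> * w z"
      proof -
        have "exp (- (\<alpha> / 2)) / (2 * (1 + norm z)) ^ m = exp (- (\<alpha> / 2)) / 2 ^ m * (1 + norm z) powr - real m"
          unfolding power_mult_distrib powr_minus powr_realpow[OF pos(1)]
          by (simp only: inverse_eq_divide times_divide_times_eq mult_1_right)
        then show ?thesis
          unfolding \<kappa>_def w_def by (simp only:) (subst powr_mult, auto simp: powr_powr)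
      qed
      ultimately have "2 ^ N / 2 * \<kappa> * w z \<le> 2 ^ card {..<N} / 2 * cmod (e k) powr q"
        by simp
      also have "\<dots> \<le> (\<Sum>S\<in>Pow {..<N}. cmod (\<Sum>k<N. (if k \<in> S then 1 else - 1) * e k) powr q)"
        using k(1) \<open>q > 0\<close> by (intro sum_signs_powr_ge) auto
      also have "\<dots> = (\<Sum>S\<in>Pow {..<N}. I N S z)"
      proof (intro sum.cong refl)
        fix S
        have "(\<Sum>k<N. (if k \<in> S then 1 else - 1) * e k)
            = test N S z * of_real (exp (- (\<alpha> / 2) * (norm z)\<^sup>2))"
          unfolding test_def exp_sum_def sum_distrib_right
          by (intro sum.cong) (auto simp: e_def c_def mult_ac)
        then show "cmod (\<Sum>k<N. (if k \<in> S then 1 else - 1) * e k) powr q = I N S z"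
          by (simp add: I_def norm_mult powr_mult exp_powr_real mult_ac)
      qed
      finally show ?thesis .
    qed
    have partial: "emeasure (weighted_measure (real m * q) \<mu>) (U N) \<le> ennreal (2 / \<kappa>) * T" for N
    proof -
      \<comment> \<open>The reciprocal of the constant in \<open>average\<close>.\<close>
      define x where "x = 2 / (2 ^ N * \<kappa>)"
      have x: "x > 0" using \<kappa> by (simp add: x_def)
      have "emeasure (weighted_measure (real m * q) \<mu>) (U N) = (\<integral>\<^sup>+ z. ennreal (w z) * indicator (U N) z \<partial>\<mu>)"
        unfolding weighted_measure_def w_def by (rule emeasure_density) (auto simp: sets U_borel)
      also have "\<dots> \<le> (\<integral>\<^sup>+ z. ennreal x * (\<Sum>S\<in>Pow {..<N}. ennreal (I N S z)) \<partial>\<mu>)"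
      proof (intro nn_integral_mono)
        fix z
        show "ennreal (w z) * indicator (U N) z \<le> ennreal x * (\<Sum>S\<in>Pow {..<N}. ennreal (I N S z))"
        proof (cases "z \<in> U N")
          case True
          have "w z \<le> x * (\<Sum>S\<in>Pow {..<N}. I N S z)"
            using mult_left_mono[OF average[OF True], of x] x \<kappa> by (simp add: x_def field_simps)
          then have "ennreal (w z) \<le> ennreal (x * (\<Sum>S\<in>Pow {..<N}. I N S z))"
            by (rule ennreal_leI)
          also have "\<dots> = ennreal x * (\<Sum>S\<in>Pow {..<N}. ennreal (I N S z))"
            using x by (subst sum_ennreal) (auto simp: I_def ennreal_mult sum_nonneg)
          finally show ?thesis using True by simp
        qed auto
      qed
      also have "\<dots> = ennreal x * (\<Sum>S\<in>Pow {..<N}. fc_integral \<alpha> q \<mu> (test N S))"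
        unfolding fc_integral_def I_def[symmetric]
        by (subst nn_integral_cmult, measurable) (subst nn_integral_sum, auto)
      also have "\<dots> \<le> ennreal x * (\<Sum>S\<in>Pow {..<N}. T)"
        by (intro mult_left_mono sum_mono T) (auto simp: F_def)
      also have "\<dots> = ennreal x * (ennreal (2 ^ N) * T)"
        by (simp add: card_Pow ennreal_power flip: ennreal_numeral)
      also have "\<dots> = ennreal (2 / \<kappa>) * T"
        using \<kappa> x by (simp add: x_def flip: ennreal_mult mult.assoc)
      finally show ?thesis .
    qed
    have "(\<Union>N. U N) = UNIV"
    proof -
      have "(\<Union>k. ball (p k) 1) = UNIV"
        using lat by (simp add: half_lattice_def)
      then show ?thesis by (auto simp: U_def set_eq_iff) blast
    qed
    moreover have "(SUP N. emeasure (weighted_measure (real m * q) \<mu>) (U N))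
        = emeasure (weighted_measure (real m * q) \<mu>) (\<Union>N. U N)"
    proof (rule SUP_emeasure_incseq)
      show "incseq U" unfolding U_def by (rule monoI, rule UN_mono) auto
    qed (use sets U_borel in auto)
    ultimately show ?thesis
      using partial by (metis SUP_least)
  qed
  show thesis
  proof (rule that[of A "2 / \<kappa>" F])
    show "A > 0" "2 / \<kappa> > 0" using G(1) \<kappa> by (auto simp: A_def)
    show "(\<lambda>z. b * f z) \<in> fock_sobolev \<alpha> m" if "f \<in> F" for f b
      using that exp_sum_in_fock_sobolev[OF \<open>\<alpha> > 0\<close>]
      by (auto simp: F_def test_def simp flip: exp_sum_cmult)
    show "(1 + norm z) ^ m * (cmod (f z) * exp (- (\<alpha> / 2) * (norm z)\<^sup>2)) \<le> A" if "f \<in> F" for f z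
      using that bound by (auto simp: F_def)
  qed (rule mass)
qed

section \<open>The embedding controls the mass\<close>

lemma ennpowr_mono: "x \<le> y \<Longrightarrow> q > 0 \<Longrightarrow> ennpowr x q \<le> ennpowr y q"
  by (cases x; cases y) (auto simp: ennpowr_def top_unique intro!: ennreal_leI powr_mono2)

lemma ennpowr_ennpowr_inverse:
  assumes "a > 0" "b > 0" "a * b = 1"
  shows "ennpowr (ennpowr x a) b = x"
  using assms by (cases x) (auto simp: ennpowr_def powr_powr)

lemma ennpowr_less_top_iff: "ennpowr x q < \<infinity> \<longleftrightarrow> x < \<infinity>"
  by (simp add: ennpowr_def less_top)

text \<open>
  Both bounds are transported through the infimum that defines the norm by taking \<open>q\<close>-th roots: the upper
  one by exhibiting an admissible constant, the lower one by bounding every admissible constant from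
  below on the test functions.
\<close>

lemma fc_norm_comparable:
  assumes "\<alpha> > 0" "q > 0"
  shows "comparable (\<lambda>\<mu> :: (complex ^ 'n::finite) measure. ennpowr (fc_norm \<alpha> m q \<mu>) q)
    (\<lambda>\<mu>. emeasure (weighted_measure (real m * q) \<mu>) UNIV)"
proof -
  define M where "M = (2 ^ m * exp (\<alpha> / 2)) powr q"
  have M: "M > 0" by (simp add: M_def)
  obtain F :: "(complex ^ 'n \<Rightarrow> complex) set" and A B :: real where AB: "A > 0" "B > 0"
    and F_mem: "\<And>f c. f \<in> F \<Longrightarrow> (\<lambda>z. c * f z) \<in> fock_sobolev \<alpha> m"
    and F_bd: "\<And>f z. f \<in> F \<Longrightarrow> (1 + norm z) ^ m * (cmod (f z) * exp (- (\<alpha> / 2) * (norm z)\<^sup>2)) \<le> A"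
    and F_mass: "\<And>\<mu> T. sets \<mu> = sets borel \<Longrightarrow> (\<And>f. f \<in> F \<Longrightarrow> fc_integral \<alpha> q \<mu> f \<le> T) \<Longrightarrow>
       emeasure (weighted_measure (real m * q) \<mu>) UNIV \<le> ennreal B * T"
    by (rule lattice_test_functions[OF assms, of m]) blast
  have inv: "ennpowr (ennpowr x (1 / q)) q = x" "ennpowr (ennpowr x q) (1 / q) = x" for x
    using \<open>q > 0\<close> by (auto intro!: ennpowr_ennpowr_inverse)
  define K where "K = B * A powr q"
  have K: "K > 0" using AB by (simp add: K_def)
  show ?thesis
  proof (rule comparableI[OF M _ K])
    fix \<mu> :: "(complex ^ 'n) measure" assume \<mu>: "sets \<mu> = sets borel"
    define W where "W = emeasure (weighted_measure (real m * q) \<mu>) UNIV"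
    have "fc_bound \<alpha> m q \<mu> (ennpowr (ennreal M * W) (1 / q))"
      unfolding fc_bound_def inv M_def W_def
      by (intro ballI fc_integral_le_fs_norm \<mu> assms) (simp add: fock_sobolev_def)
    then have "fc_norm \<alpha> m q \<mu> \<le> ennpowr (ennreal M * W) (1 / q)"
      unfolding fc_norm_def by (intro Inf_lower) simp
    then have "ennpowr (fc_norm \<alpha> m q \<mu>) q \<le> ennpowr (ennpowr (ennreal M * W) (1 / q)) q"
      using \<open>q > 0\<close> by (rule ennpowr_mono)
    then show "ennpowr (fc_norm \<alpha> m q \<mu>) q
        \<le> ennreal M * emeasure (weighted_measure (real m * q) \<mu>) UNIV"
      by (simp add: inv W_def)
    have "ennpowr (ennreal (1 / K) * W) (1 / q) \<le> C" if C: "fc_bound \<alpha> m q \<mu> C" for C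
    proof -
      have "fc_integral \<alpha> q \<mu> f \<le> ennpowr C q * ennreal (A powr q)" if f: "f \<in> F" for f
      proof -
        have "fs_norm \<alpha> m f \<le> ennreal A"
          unfolding fs_norm_def
        proof (intro SUP_least ennreal_leI order.trans[OF _ F_bd[OF f]])
          fix z
          show "norm z ^ m * cmod (f z) * exp (- (\<alpha> / 2) * (norm z)\<^sup>2)
              \<le> (1 + norm z) ^ m * (cmod (f z) * exp (- (\<alpha> / 2) * (norm z)\<^sup>2))"
            unfolding mult.assoc by (intro mult_right_mono power_mono) auto
        qed
        then have "ennpowr (fs_norm \<alpha> m f) q \<le> ennpowr (ennreal A) q"
          using \<open>q > 0\<close> by (rule ennpowr_mono)
        also have "\<dots> = ennreal (A powr q)"
          using AB by (simp add: ennpowr_def)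
        finally have "ennpowr C q * ennpowr (fs_norm \<alpha> m f) q \<le> ennpowr C q * ennreal (A powr q)"
          by (rule mult_left_mono) simp
        moreover have "fc_integral \<alpha> q \<mu> f \<le> ennpowr C q * ennpowr (fs_norm \<alpha> m f) q"
          using C F_mem[OF f, of 1] by (simp add: fc_bound_def)
        ultimately show ?thesis by (rule order.trans[rotated])
      qed
      then have "W \<le> ennreal B * (ennpowr C q * ennreal (A powr q))"
        unfolding W_def by (rule F_mass[OF \<mu>])
      also have "\<dots> = ennreal K * ennpowr C q"
        using AB by (simp add: K_def ennreal_mult mult_ac)
      finally have "ennreal (1 / K) * W \<le> ennreal (1 / K) * (ennreal K * ennpowr C q)"
        by (rule mult_left_mono) simp
      also have "\<dots> = ennpowr C q"
        using K by (simp flip: mult.assoc ennreal_mult)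
      finally have "ennpowr (ennreal (1 / K) * W) (1 / q) \<le> ennpowr (ennpowr C q) (1 / q)"
        using \<open>q > 0\<close> by (intro ennpowr_mono) auto
      then show ?thesis by (simp add: inv)
    qed
    then have "ennpowr (ennreal (1 / K) * W) (1 / q) \<le> fc_norm \<alpha> m q \<mu>"
      unfolding fc_norm_def by (intro Inf_greatest) auto
    then have "ennpowr (ennpowr (ennreal (1 / K) * W) (1 / q)) q \<le> ennpowr (fc_norm \<alpha> m q \<mu>) q"
      using \<open>q > 0\<close> by (rule ennpowr_mono)
    then have "ennreal K * (ennreal (1 / K) * W) \<le> ennreal K * ennpowr (fc_norm \<alpha> m q \<mu>) q"
      unfolding inv by (rule mult_left_mono) simp
    then show "emeasure (weighted_measure (real m * q) \<mu>) UNIV \<le> ennreal K * ennpowr (fc_norm \<alpha> m q \<mu>) q"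
      using K by (simp add: W_def flip: mult.assoc ennreal_mult)
  qed
qed

lemma fock_carleson_iff_fc_norm: "fock_carleson \<alpha> m q \<mu> \<longleftrightarrow> ennpowr (fc_norm \<alpha> m q \<mu>) q < \<infinity>"
  unfolding ennpowr_less_top_iff fock_carleson_def fc_norm_def Inf_less_iff by auto

text \<open>
  If the mass is infinite, there are test functions \<open>f\<^sub>j\<close> of uniformly bounded norm whose integrals exceed
  \<open>(j + 1)\<^sup>q\<close>. The functions \<open>f\<^sub>j / (j + 1)\<close> then tend to zero in norm, hence uniformly on compact sets,
  but their integrals stay above \<open>1\<close>.
\<close>

lemma finite_mass_if_vanishing:
  fixes \<mu> :: "(complex ^ 'n::finite) measure"
  assumes "\<alpha> > 0" "q > 0" and \<mu>: "sets \<mu> = sets borel"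
    and van: "vanishing_fock_carleson \<alpha> m q \<mu>"
  shows "emeasure (weighted_measure (real m * q) \<mu>) UNIV < \<infinity>"
proof (rule ccontr)
  assume inf: "\<not> emeasure (weighted_measure (real m * q) \<mu>) UNIV < \<infinity>"
  have [measurable_cong]: "sets \<mu> = sets borel" by (rule \<mu>)
  obtain F :: "(complex ^ 'n \<Rightarrow> complex) set" and A B :: real where AB: "A > 0" "B > 0"
    and F_mem: "\<And>f c. f \<in> F \<Longrightarrow> (\<lambda>z. c * f z) \<in> fock_sobolev \<alpha> m"
    and F_bd: "\<And>f z. f \<in> F \<Longrightarrow> (1 + norm z) ^ m * (cmod (f z) * exp (- (\<alpha> / 2) * (norm z)\<^sup>2)) \<le> A"
    and F_mass: "\<And>\<mu> T. sets \<mu> = sets borel \<Longrightarrow> (\<And>f. f \<in> F \<Longrightarrow> fc_integral \<alpha> q \<mu> f \<le> T) \<Longrightarrow>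
       emeasure (weighted_measure (real m * q) \<mu>) UNIV \<le> ennreal B * T"
    by (rule lattice_test_functions[OF assms(1,2), of m]) blast
  have "\<exists>f\<in>F. ennreal ((real j + 1) powr q) < fc_integral \<alpha> q \<mu> f" for j :: nat
  proof (rule ccontr)
    assume "\<not> ?thesis"
    then have "emeasure (weighted_measure (real m * q) \<mu>) UNIV \<le> ennreal B * ennreal ((real j + 1) powr q)"
      by (intro F_mass[OF \<mu>]) (auto simp: not_less)
    also have "\<dots> < \<infinity>"
      by (simp add: ennreal_mult_less_top)
    finally show False using inf by simp
  qed
  then obtain f where f: "\<And>j. f j \<in> F" "\<And>j :: nat. ennreal ((real j + 1) powr q) < fc_integral \<alpha> q \<mu> (f j)"
    by metis
  define g where "g j z = complex_of_real (1 / (real j + 1)) * f j z" for j z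
  have norm_g: "cmod (g j z) = cmod (f j z) / (real j + 1)" for j z
    unfolding g_def norm_mult norm_of_real by simp
  have g_mem: "g j \<in> fock_sobolev \<alpha> m" for j
    unfolding g_def by (rule F_mem[OF f(1)])
  have f_meas [measurable]: "f j \<in> borel_measurable borel" for j
    using F_mem[OF f(1), of 1 j] by (intro borel_measurable_entire_fun) (simp add: fock_sobolev_def)
  have g_bd: "(1 + norm z) ^ m * (cmod (g j z) * exp (- (\<alpha> / 2) * (norm z)\<^sup>2)) \<le> A / (real j + 1)" for j z
    using divide_right_mono[OF F_bd[OF f(1), of z j], of "real j + 1"] by (simp add: norm_g)
  have "(SUP j. fs_norm \<alpha> m (g j)) \<le> ennreal A"
    unfolding fs_norm_def
  proof (intro SUP_least ennreal_leI)
    fix j z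
    have "norm z ^ m * cmod (g j z) * exp (- (\<alpha> / 2) * (norm z)\<^sup>2)
        \<le> (1 + norm z) ^ m * (cmod (g j z) * exp (- (\<alpha> / 2) * (norm z)\<^sup>2))"
      unfolding mult.assoc by (intro mult_right_mono power_mono) auto
    also have "\<dots> \<le> A / (real j + 1)"
      by (rule g_bd)
    also have "\<dots> \<le> A"
      using AB by (simp add: divide_le_eq mult_le_cancel_left1)
    finally show "norm z ^ m * cmod (g j z) * exp (- (\<alpha> / 2) * (norm z)\<^sup>2) \<le> A" .
  qed
  then have g_sup: "(SUP j. fs_norm \<alpha> m (g j)) < \<infinity>"
    by (rule order.strict_trans1) simp
  have g_lim: "uniform_limit K g (\<lambda>_. 0) sequentially" if K: "compact K" for K
  proof (rule uniform_limitI)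
    fix e :: real assume "e > 0"
    obtain R where R: "R > 0" "\<And>z. z \<in> K \<Longrightarrow> norm z \<le> R"
      using compact_imp_bounded[OF K] by (auto simp: bounded_pos)
    define E where "E = A * exp (\<alpha> / 2 * R\<^sup>2)"
    have "(\<lambda>j. E / (real j + 1)) \<longlonglongrightarrow> 0"
      using LIMSEQ_Suc[OF lim_const_over_n[of E]] by (simp add: add.commute)
    then have "eventually (\<lambda>j. E / (real j + 1) < e) sequentially"
      using \<open>e > 0\<close> by (rule order_tendstoD)
    then show "eventually (\<lambda>j. \<forall>z\<in>K. dist (g j z) 0 < e) sequentially"
    proof eventually_elim
      case (elim j)
      have "cmod (g j z) \<le> E / (real j + 1)" if "z \<in> K" for z
      proof -
        have "1 * (cmod (g j z) * exp (- (\<alpha> / 2) * (norm z)\<^sup>2))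
            \<le> (1 + norm z) ^ m * (cmod (g j z) * exp (- (\<alpha> / 2) * (norm z)\<^sup>2))"
          by (intro mult_right_mono one_le_power) auto
        then have "cmod (g j z) * exp (- (\<alpha> / 2) * (norm z)\<^sup>2) \<le> A / (real j + 1)"
          using g_bd[of z j] by simp
        moreover have "exp (- (\<alpha> / 2 * R\<^sup>2)) \<le> exp (- (\<alpha> / 2) * (norm z)\<^sup>2)"
          using R(2)[OF that] \<open>\<alpha> > 0\<close> by (auto intro!: mult_left_mono power_mono)
        ultimately have "cmod (g j z) * exp (- (\<alpha> / 2 * R\<^sup>2)) \<le> A / (real j + 1)"
          by (meson mult_left_mono norm_ge_zero order.trans)
        from mult_right_mono[OF this, of "exp (\<alpha> / 2 * R\<^sup>2)"]
        show ?thesis by (simp add: E_def mult.assoc flip: exp_add)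
      qed
      with elim show ?case by (auto intro: order.strict_trans1)
    qed
  qed
  have "(\<lambda>j. fc_integral \<alpha> q \<mu> (g j)) \<longlonglongrightarrow> 0"
    using van g_mem g_sup g_lim unfolding vanishing_fock_carleson_def by blast
  moreover have "1 \<le> fc_integral \<alpha> q \<mu> (g j)" for j
  proof -
    define a where "a = (1 / (real j + 1)) powr q"
    have inv: "a * (real j + 1) powr q = 1"
      by (simp add: a_def powr_divide)
    have "fc_integral \<alpha> q \<mu> (g j) = ennreal a * fc_integral \<alpha> q \<mu> (f j)"
      unfolding fc_integral_def
      by (subst nn_integral_cmult[symmetric])
         (auto intro!: nn_integral_cong simp: norm_g a_def powr_divide simp flip: ennreal_mult)
    moreover have "ennreal a * ennreal ((real j + 1) powr q) \<le> ennreal a * fc_integral \<alpha> q \<mu> (f j)"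
      using f(2)[of j] by (intro mult_left_mono) auto
    ultimately show ?thesis
      using inv by (simp add: a_def flip: ennreal_mult)
  qed
  ultimately have "(1 :: ennreal) \<le> 0"
    by (intro LIMSEQ_le_const) auto
  then show False by simp
qed

section \<open>The characterisation of Fock--Carleson measures\<close>

theorem theorem2p4:
  fixes \<alpha> q :: real and m :: nat
  assumes "\<alpha> > 0" and "q > 0"
  shows
    "(\<forall>\<mu> :: (complex ^ 'n::finite) measure. sets \<mu> = sets borel \<longrightarrow>
        (fock_carleson \<alpha> m q \<mu> \<longleftrightarrow> vanishing_fock_carleson \<alpha> m q \<mu>) \<and>
        (fock_carleson \<alpha> m q \<mu> \<longleftrightarrow> (\<exists>t>0. in_L1 (berezin \<alpha> t (real m * q) \<mu>))) \<and>
        (fock_carleson \<alpha> m q \<mu> \<longleftrightarrow> (\<forall>t>0. in_L1 (berezin \<alpha> t (real m * q) \<mu>))) \<and>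
        (fock_carleson \<alpha> m q \<mu> \<longleftrightarrow> (\<exists>r>0. in_L1 (averaged (real m * q) r \<mu>))) \<and>
        (fock_carleson \<alpha> m q \<mu> \<longleftrightarrow> (\<forall>r>0. in_L1 (averaged (real m * q) r \<mu>))) \<and>
        (fock_carleson \<alpha> m q \<mu> \<longleftrightarrow>
           (\<exists>r>0. \<exists>z. half_lattice r z \<and> (\<Sum>k. averaged (real m * q) r \<mu> (z k)) < \<infinity>)) \<and>
        (fock_carleson \<alpha> m q \<mu> \<longleftrightarrow>
           (\<forall>r>0. \<forall>z. half_lattice r z \<longrightarrow> (\<Sum>k. averaged (real m * q) r \<mu> (z k)) < \<infinity>)) \<and>
        (fock_carleson \<alpha> m q \<mu> \<longleftrightarrow> finite_measure (weighted_measure (real m * q) \<mu>))) \<and>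
     (\<forall>t>0. \<forall>r>0. \<forall>z :: nat \<Rightarrow> complex ^ 'n. half_lattice r z \<longrightarrow>
        comparable (\<lambda>\<mu> :: (complex ^ 'n) measure. ennpowr (fc_norm \<alpha> m q \<mu>) q)
                   (\<lambda>\<mu>. L1_norm (berezin \<alpha> t (real m * q) \<mu>)) \<and>
        comparable (\<lambda>\<mu> :: (complex ^ 'n) measure. L1_norm (berezin \<alpha> t (real m * q) \<mu>))
                   (\<lambda>\<mu>. L1_norm (averaged (real m * q) r \<mu>)) \<and>
        comparable (\<lambda>\<mu> :: (complex ^ 'n) measure. L1_norm (averaged (real m * q) r \<mu>))
                   (\<lambda>\<mu>. emeasure (weighted_measure (real m * q) \<mu>) UNIV) \<and>
        comparable (\<lambda>\<mu> :: (complex ^ 'n) measure. emeasure (weighted_measure (real m * q) \<mu>) UNIV)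
                   (\<lambda>\<mu>. (\<Sum>k. averaged (real m * q) r \<mu> (z k))))"
proof (intro conjI allI impI)
  define s where "s = real m * q"
  have s: "s \<ge> 0" using assms by (simp add: s_def)
  note berezin = berezin_comparable[OF \<open>\<alpha> > 0\<close>, of _ s]
  note average = averaged_comparable[OF s]
  note lattice = lattice_sum_comparable[OF _ s]
  note embedding = fc_norm_comparable[OF assms, of m, folded s_def]
  obtain p :: "nat \<Rightarrow> complex ^ 'n" where p: "half_lattice 1 p"
    by (rule half_lattice_exists[OF zero_less_one])
  {
    fix \<mu> :: "(complex ^ 'n) measure" assume \<mu>: "sets \<mu> = sets borel"
    define fin where "fin \<longleftrightarrow> emeasure (weighted_measure s \<mu>) UNIV < \<infinity>"
    have carleson: "fock_carleson \<alpha> m q \<mu> \<longleftrightarrow> fin"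
      unfolding fock_carleson_iff_fc_norm fin_def by (rule comparable_finite_iff[OF embedding \<mu>])
    have vanishing: "vanishing_fock_carleson \<alpha> m q \<mu> \<longleftrightarrow> fin"
      unfolding fin_def s_def using assms \<mu> vanishing_if_finite_mass finite_mass_if_vanishing by blast
    have L1_berezin: "in_L1 (berezin \<alpha> t s \<mu>) \<longleftrightarrow> fin" if "t > 0" for t
      using comparable_finite_iff[OF berezin[OF that] \<mu>] berezin_measurable[OF \<mu>, of s]
      by (auto simp: in_L1_def fin_def)
    have L1_average: "in_L1 (averaged s r \<mu>) \<longleftrightarrow> fin" if "r > 0" for r
      using comparable_finite_iff[OF average[OF that] \<mu>] averaged_measurable[OF \<mu>, of s r]
      by (auto simp: in_L1_def fin_def)
    have sum_lattice: "(\<Sum>k. averaged s r \<mu> (z k)) < \<infinity> \<longleftrightarrow> fin" if "half_lattice r z" for r z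
      using comparable_finite_iff[OF lattice[OF that] \<mu>] by (simp add: fin_def)
    have "space (weighted_measure s \<mu>) = UNIV"
      using sets_eq_imp_space_eq[of "weighted_measure s \<mu>" borel] \<mu> by simp
    then have finite: "finite_measure (weighted_measure s \<mu>) \<longleftrightarrow> fin"
      by (auto simp: fin_def less_top intro: finite_measureI dest: finite_measure.emeasure_finite)
    show "fock_carleson \<alpha> m q \<mu> \<longleftrightarrow> vanishing_fock_carleson \<alpha> m q \<mu>"
      using carleson vanishing by simp
    show "fock_carleson \<alpha> m q \<mu> \<longleftrightarrow> (\<exists>t>0. in_L1 (berezin \<alpha> t (real m * q) \<mu>))"
      "fock_carleson \<alpha> m q \<mu> \<longleftrightarrow> (\<forall>t>0. in_L1 (berezin \<alpha> t (real m * q) \<mu>))"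
      using carleson L1_berezin zero_less_one unfolding s_def[symmetric] by blast+
    show "fock_carleson \<alpha> m q \<mu> \<longleftrightarrow> (\<exists>r>0. in_L1 (averaged (real m * q) r \<mu>))"
      "fock_carleson \<alpha> m q \<mu> \<longleftrightarrow> (\<forall>r>0. in_L1 (averaged (real m * q) r \<mu>))"
      using carleson L1_average zero_less_one unfolding s_def[symmetric] by blast+
    show "fock_carleson \<alpha> m q \<mu> \<longleftrightarrow>
        (\<exists>r>0. \<exists>z. half_lattice r z \<and> (\<Sum>k. averaged (real m * q) r \<mu> (z k)) < \<infinity>)"
      "fock_carleson \<alpha> m q \<mu> \<longleftrightarrow>
        (\<forall>r>0. \<forall>z. half_lattice r z \<longrightarrow> (\<Sum>k. averaged (real m * q) r \<mu> (z k)) < \<infinity>)"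
      using carleson sum_lattice p zero_less_one unfolding s_def[symmetric] by blast+
    show "fock_carleson \<alpha> m q \<mu> \<longleftrightarrow> finite_measure (weighted_measure (real m * q) \<mu>)"
      using carleson finite unfolding s_def[symmetric] by simp
  }
  {
    fix t r :: real and z :: "nat \<Rightarrow> complex ^ 'n"
    assume tr: "t > 0" "r > 0" and z: "half_lattice r z"
    note hub = berezin[OF tr(1)] average[OF tr(2)] lattice[OF z]
    show "comparable (\<lambda>\<mu> :: (complex ^ 'n) measure. ennpowr (fc_norm \<alpha> m q \<mu>) q)
        (\<lambda>\<mu>. L1_norm (berezin \<alpha> t (real m * q) \<mu>))"
      unfolding s_def[symmetric] by (rule comparable_trans[OF embedding comparable_sym[OF hub(1)]])
    show "comparable (\<lambda>\<mu> :: (complex ^ 'n) measure. L1_norm (berezin \<alpha> t (real m * q) \<mu>))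
        (\<lambda>\<mu>. L1_norm (averaged (real m * q) r \<mu>))"
      unfolding s_def[symmetric] by (rule comparable_trans[OF hub(1) comparable_sym[OF hub(2)]])
    show "comparable (\<lambda>\<mu> :: (complex ^ 'n) measure. L1_norm (averaged (real m * q) r \<mu>))
        (\<lambda>\<mu>. emeasure (weighted_measure (real m * q) \<mu>) UNIV)"
      unfolding s_def[symmetric] by (rule hub(2))
    show "comparable (\<lambda>\<mu> :: (complex ^ 'n) measure. emeasure (weighted_measure (real m * q) \<mu>) UNIV)
        (\<lambda>\<mu>. (\<Sum>k. averaged (real m * q) r \<mu> (z k)))"
      unfolding s_def[symmetric] by (rule comparable_sym[OF hub(3)])
  }
qed

end
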